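(* There exists a minimal $4$-interval exchange transformation $T\colon[0,1)\to[0,1)$ and a number $b\in[\tfrac14,\tfrac34]$ such that the function $\phi_1(x,y)=\liminf_{n\to\infty} n\,|T^n(x)-y|$ satisfies: $\phi_1(x,y)\in\{0,\infty\}$ for $\lambda\times\lambda$-a.e. $(x,y)$, and $(\lambda\times\lambda)(\{(x,y):\phi_1(x,y)=0\})=b$, where $\lambda$ is Lebesgue measure on $[0,1)$.
   Context: An $r$-interval exchange transformation (IET) is given by a permutation $\pi$ of $\{1,\dots,r\}$ and a vector $(\ell_1,\dots,\ell_r)$ with all $\ell_i>0$ and $\sum\ell_i=1$: with $s_0=0$, $s_k=\sum_{i\le k}\ell_i$ and $I_k=[s_{k-1},s_k)$, one sets $T(x)=x-\sum_{i<k}\ell_i+\sum_{\pi(i')<\pi(k)}\ell_{i'}$ for $x\in I_k$. $T$ is minimal if every orbit is dense in $[0,1)$. *)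

theory Defs
  imports "HOL-Probability.Probability"
begin

definition iet_data :: "nat \<Rightarrow> (nat \<Rightarrow> nat) \<Rightarrow> (nat \<Rightarrow> real) \<Rightarrow> bool" where
  "iet_data r prm l \<longleftrightarrow> bij_betw prm {1..r} {1..r} \<and> (\<forall>i\<in>{1..r}. l i > 0) \<and> (\<Sum>i=1..r. l i) = 1"

definition iet_s :: "(nat \<Rightarrow> real) \<Rightarrow> nat \<Rightarrow> real" where
  "iet_s l k = (\<Sum>i=1..k. l i)"

definition iet :: "nat \<Rightarrow> (nat \<Rightarrow> nat) \<Rightarrow> (nat \<Rightarrow> real) \<Rightarrow> real \<Rightarrow> real" where
  "iet r prm l x =
    (if \<exists>k\<in>{1..r}. iet_s l (k - 1) \<le> x \<and> x < iet_s l k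
     then (let k = (THE k. k \<in> {1..r} \<and> iet_s l (k - 1) \<le> x \<and> x < iet_s l k)
           in x - (\<Sum>i\<in>{1..<k}. l i) + (\<Sum>i'\<in>{i'\<in>{1..r}. prm i' < prm k}. l i'))
     else x)"

definition minimal_map :: "(real \<Rightarrow> real) \<Rightarrow> bool" where
  "minimal_map T \<longleftrightarrow> (\<forall>x\<in>{0..<1}. {0..<1} \<subseteq> closure (range (\<lambda>n. (T ^^ n) x)))"

definition lambda01 :: "real measure" where
  "lambda01 = restrict_space lborel {0..<1}"

definition phi1 :: "(real \<Rightarrow> real) \<Rightarrow> real \<Rightarrow> real \<Rightarrow> ereal" where
  "phi1 T x y = liminf (\<lambda>n. ereal (real n * \<bar>(T ^^ n) x - y\<bar>))"

end

theory Submission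
  imports Defs "HOL-Real_Asymp.Real_Asymp"
begin

text \<open>
  The transformation is one of Keane's minimal but not uniquely ergodic 4-interval exchanges.
  At every stage \<open>k\<close> of the renormalization the unit interval splits into four Rokhlin towers.
  Two of them, the second and the third, always carry mass at least \<open>1/4\<close>, and the mass of the
  other two is summable in \<open>k\<close>. Almost every point therefore eventually stays in the second tower
  (the set \<open>A\<close>) or eventually stays in the third (the set \<open>B\<close>).

  The tower of stage \<open>k + 1\<close> is a very long stack of copies of the tower of stage \<open>k\<close> with few
  additional levels. An orbit starting in \<open>A\<close> stays in the second tower of stage \<open>k + 1\<close> for a time
  much longer than the inverse of its distance to a typical point of \<open>B\<close>, so \<open>\<phi>\<^sub>1 = \<infinity>\<close> on
  \<open>A \<times> B\<close> and \<open>B \<times> A\<close> by the Borel--Cantelli lemma.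
  Inside one tower the first return to a level is a translation by a tiny drift. Two points of the
  tower whose offsets differ by at most the fraction \<open>\<epsilon>\<close> of the width of a level therefore satisfy
  \<open>n \<bar>T\<^sup>n x - y\<bar> \<le> 2 \<epsilon>\<close> for some large \<open>n\<close>, and a density argument shows that almost every pair in
  \<open>A \<times> A\<close> or \<open>B \<times> B\<close> is in this situation at infinitely many stages, whence \<open>\<phi>\<^sub>1 = 0\<close>.
  So \<open>b = \<lambda>(A)\<^sup>2 + \<lambda>(B)\<^sup>2\<close>.
\<close>

section \<open>Towers with a small drift\<close>

text \<open>The parameters are chosen stage by stage: the heights \<open>h k\<close> fix
  \<open>n k\<close>, and \<open>n k\<close> fixes \<open>m k\<close>, each at least
  \<open>8^(k+1)\<close> times the number of levels it has to outweigh. A long run of one letter in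
  a return itinerary has two effects. It fills the next tower of that kind almost entirely with
  copies of the current one, and it forces a tiny drift, because the whole run fits into the width
  of one piece. One inequality thus controls both lost mass and speed. The base 8 is
  \<open>2 * 2 * 2\<close>: one factor \<open>2^k\<close> pays for the margin in
  \<open>deep\<close>, one for summability in \<open>sep\<close>, and the third makes
  \<open>stay_time k * sep k\<close> diverge. The obstacle on \<open>A \<times> B\<close> is the
  time between two stages: a time known only to exceed the staying time of stage k must be handled
  with the tower of stage k + 1. The additional levels of the later tower therefore enter the
  estimates of the earlier one; this is why \<open>e k\<close> appears in \<open>growth\<close>.
  Lengths of one stage are determined by those of the next, so the initial lengths come from
  arbitrarily late stages, and compactness supplies them.\<close>

lemma AE_eventually_notin:
  fixes B :: "nat \<Rightarrow> real set"
  assumes "\<And>k. B k \<in> sets borel" "\<And>k. emeasure lborel (B k) \<le> ennreal (C / 2 ^ k)" "0 \<le> C"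
  shows "AE x in lborel. \<forall>\<^sub>F k in sequentially. x \<notin> B k"
proof -
  have fin: "emeasure lborel (B k) < \<infinity>" for k
    using assms(2)[of k] by (metis ennreal_less_top infinity_ennreal_def le_less_trans)
  have le: "measure lborel (B k) \<le> C / 2 ^ k" for k
    using assms by (simp add: measure_def enn2real_leI)
  have "summable (\<lambda>k. C * (1/2) ^ k)"
    by (intro summable_mult summable_geometric) auto
  then have "summable (\<lambda>k. measure lborel (B k))"
    by (rule summable_comparison_test'[where N=0]) (use le in \<open>simp add: power_divide\<close>)
  from borel_cantelli_AE1[OF _ fin this] assms(1) show ?thesis by simp
qed

lemma emeasure_cover_le:
  fixes a :: "'i \<Rightarrow> real"
  assumes "finite I" "S \<subseteq> (\<Union>i\<in>I. {a i..b i})" "\<And>i. i \<in> I \<Longrightarrow> a i \<le> b i" "(\<Sum>i\<in>I. b i - a i) \<le> C"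
  shows "emeasure lborel S \<le> ennreal C"
proof -
  have "emeasure lborel S \<le> emeasure lborel (\<Union>i\<in>I. {a i..b i})"
    using assms by (intro emeasure_mono) auto
  also have "\<dots> \<le> (\<Sum>i\<in>I. emeasure lborel {a i..b i})"
    using assms by (intro emeasure_subadditive_finite) auto
  also have "\<dots> = (\<Sum>i\<in>I. ennreal (b i - a i))"
    using assms by (intro sum.cong) auto
  also have "\<dots> = ennreal (\<Sum>i\<in>I. b i - a i)"
    using assms by (subst sum_ennreal) (auto)
  also have "\<dots> \<le> ennreal C" using assms by (intro ennreal_leI)
  finally show ?thesis .
qed

text \<open>
  At stage \<open>k\<close> the tower has \<open>H k\<close> levels of width \<open>W k\<close> with left endpoints \<open>lo k j\<close>, and \<open>T\<^sup>H\<close> translates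
  a level by \<open>d k\<close> in the direction \<open>sg k = \<plusminus>1\<close>. All levels of stage \<open>k + 1\<close> but \<open>e k\<close> many lie in the
  tower of stage \<open>k\<close>. By \<open>growth\<close> a point passes its level at least \<open>8\<^sup>k (1 + e/H)\<close> times in a row.
\<close>
locale tower_sequence =
  fixes T :: "real \<Rightarrow> real" and H :: "nat \<Rightarrow> nat" and lo :: "nat \<Rightarrow> nat \<Rightarrow> real"
    and W d sg :: "nat \<Rightarrow> real" and e :: "nat \<Rightarrow> nat"
  fixes lev :: "nat \<Rightarrow> nat \<Rightarrow> real set" and X :: "nat \<Rightarrow> real set"
  defines lev_def: "lev \<equiv> \<lambda>k j. {lo k j<..<lo k j + W k}"
  defines X_def: "X \<equiv> \<lambda>k. \<Union>j<H k. lev k j"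
  assumes H_pos: "0 < H k" and W_pos: "0 < W k" and d_pos: "0 < d k" and sg: "sg k = 1 \<or> sg k = -1"
    and up: "Suc j < H k \<Longrightarrow> x \<in> lev k j \<Longrightarrow> T x = x + (lo k (Suc j) - lo k j)"
    and wrap: "x \<in> lev k (H k - 1) \<Longrightarrow> x + sg k * d k \<in> lev k (H k - 1) \<Longrightarrow>
      T x = x + (lo k 0 - lo k (H k - 1)) + sg k * d k"
    and disjoint: "i < H k \<Longrightarrow> j < H k \<Longrightarrow> i \<noteq> j \<Longrightarrow> lev k i \<inter> lev k j = {}"
    and X_subset: "X k \<subseteq> {0..<1}"
    and nest: "\<exists>J. finite J \<and> card J \<le> e k \<and> X (Suc k) \<subseteq> X k \<union> (\<Union>j\<in>J. lev (Suc k) j)"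
    and growth: "8 ^ k * real (H k + e k) * d k \<le> W k * real (H k)"
    and extra: "real (e k) * W (Suc k) \<le> 1 / 2 ^ k"
    and W_small: "W k \<le> 1 / 2 ^ k"
begin

lemma X_meas [measurable]: "X k \<in> sets borel" "lev k j \<in> sets borel"
  by (auto simp: X_def lev_def)

lemma emeasure_X: "emeasure lborel (X k) = ennreal (real (H k) * W k)"
proof -
  have "emeasure lborel (X k) = (\<Sum>j<H k. emeasure lborel (lev k j))"
    unfolding X_def using disjoint
    by (intro sum_emeasure[symmetric]) (auto simp: disjoint_family_on_def)
  also have "\<dots> = (\<Sum>j<H k. ennreal (W k))"
    using W_pos by (intro sum.cong) (auto simp: lev_def less_imp_le)
  also have "\<dots> = ennreal (real (H k) * W k)"
    using W_pos[of k] by (simp add: ennreal_mult ennreal_of_nat_eq_real_of_nat)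
  finally show ?thesis .
qed

lemma HW_le: "real (H k) * W k \<le> 1"
proof -
  have "emeasure lborel (X k) \<le> emeasure lborel {0..<1::real}"
    using X_subset by (intro emeasure_mono) auto
  then show ?thesis by (simp add: emeasure_X)
qed

lemma dH_le: "d k * real (H k + e k) \<le> 1 / 8 ^ k"
proof -
  have "8 ^ k * real (H k + e k) * d k \<le> 1" using growth[of k] HW_le[of k] by (simp add: mult.commute)
  then show ?thesis by (simp add: field_simps)
qed

lemma lev_between:
  assumes "x \<in> lev k j" "x + sg k * b \<in> lev k j" "0 \<le> a" "a \<le> b"
  shows "x + sg k * a \<in> lev k j"
  using assms sg[of k] by (auto simp: lev_def)

text \<open>Only the final position of the drifting point is required to stay in the level: the
  level is an interval and the drift has a fixed direction, so all earlier passes lie in it by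
  \<open>lev_between\<close>.\<close>

lemma funpow_lev:
  assumes "j < H k" "x \<in> lev k j" "x + sg k * (d k * real ((j + n) div H k)) \<in> lev k j"
  shows "(T ^^ n) x = x + (lo k ((j + n) mod H k) - lo k j) + sg k * (d k * real ((j + n) div H k))"
  using assms
proof (induction n)
  case 0
  then show ?case by simp
next
  case (Suc n)
  define q r where "q = (j + n) div H k" and "r = (j + n) mod H k"
  have dp: "0 \<le> d k" using d_pos[of k] by simp
  have r: "r < H k" using H_pos by (simp add: r_def)
  have jn: "j + n = q * H k + r" unfolding q_def r_def by (rule div_mult_mod_eq[symmetric])
  have "q \<le> (j + Suc n) div H k" unfolding q_def by (intro div_le_mono) simp
  then have xq: "x + sg k * (d k * real q) \<in> lev k j"
    using dp by (subst lev_between[OF Suc.prems(2,3)]) (simp_all add: mult_left_mono)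
  have IH: "(T ^^ n) x = x + (lo k r - lo k j) + sg k * (d k * real q)"
    using Suc.IH Suc.prems xq by (simp add: q_def r_def)
  have z: "(T ^^ n) x \<in> lev k r" using xq unfolding IH lev_def by auto
  show ?case
  proof (cases "Suc r < H k")
    case True
    have "j + Suc n = Suc r + q * H k" using jn by simp
    then have "(j + Suc n) div H k = q" "(j + Suc n) mod H k = Suc r"
      using True by (simp_all only: div_mult_self1 mod_mult_self1 div_less mod_less)
    then show ?thesis using up[OF True z] IH by simp
  next
    case False
    then have r': "r = H k - 1" using r by simp
    then have "j + Suc n = Suc q * H k" using jn H_pos[of k] by simp
    then have dm: "(j + Suc n) div H k = Suc q" "(j + Suc n) mod H k = 0"
      using H_pos[of k] by (simp_all del: mult_Suc)
    have "x + sg k * (d k * real (Suc q)) \<in> lev k j" using Suc.prems(3) dm by simp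
    then have "(T ^^ n) x + sg k * d k \<in> lev k r"
      unfolding IH lev_def by (auto simp: algebra_simps)
    from wrap[OF z[unfolded r'] this[unfolded r']] show ?thesis
      unfolding dm by (simp add: IH r' algebra_simps)
  qed
qed

text \<open>A deep point remains in the tower up to \<open>stay_time\<close>, and \<open>sep\<close> is so small that few points
  outside the tower are within \<open>sep k\<close> of the next tower, although \<open>stay_time k * sep k\<close> tends to infinity.\<close>
definition deep :: "nat \<Rightarrow> real set" where
  "deep k = (\<Union>j<H k. {x \<in> lev k j. x + sg k * (W k / 2 ^ k) \<in> lev k j})"

definition stay_time :: "nat \<Rightarrow> real" where
  "stay_time k = real (H k) * (W k / (2 ^ k * d k) - 1)"

definition sep :: "nat \<Rightarrow> real" where
  "sep k = 1 / (2 ^ k * real (H k + e k))"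

lemma stay:
  assumes "x \<in> deep k" "real n \<le> stay_time k"
  shows "(T ^^ n) x \<in> X k"
proof -
  obtain j where j: "j < H k" "x \<in> lev k j" "x + sg k * (W k / 2 ^ k) \<in> lev k j"
    using assms by (auto simp: deep_def)
  have "real ((j + n) div H k) \<le> real (j + n) / real (H k)" by (rule of_nat_div_le_of_nat)
  \<comment> \<open>Starting at level \<open>j < H k\<close> can cause one wrap more than
    \<open>n / H k\<close> accounts for; this is the \<open>- 1\<close> in
    \<open>stay_time\<close>.\<close>
  also have "\<dots> \<le> real n / real (H k) + 1" using j H_pos[of k] by (simp add: field_simps)
  also have "\<dots> \<le> W k / (2 ^ k * d k)"
  proof -
    have "real n / real (H k) \<le> W k / (2 ^ k * d k) - 1"
      using assms(2) H_pos[of k] by (simp add: stay_time_def pos_divide_le_eq mult.commute)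
    then show ?thesis by simp
  qed
  finally have "d k * real ((j + n) div H k) \<le> W k / 2 ^ k"
    using d_pos[of k] by (simp add: field_simps)
  then have *: "x + sg k * (d k * real ((j + n) div H k)) \<in> lev k j"
    using d_pos[of k] by (subst lev_between[OF j(2,3)]) simp_all
  have "(j + n) mod H k < H k" using H_pos by simp
  moreover have "(T ^^ n) x \<in> lev k ((j + n) mod H k)"
    using * unfolding funpow_lev[OF j(1,2) *] lev_def by auto
  ultimately show ?thesis by (auto simp: X_def)
qed

lemma stay_time_ge: "stay_time k \<ge> (4 ^ k - 1) * real (H k + e k)"
proof -
  have "8 ^ k * real (H k + e k) \<le> W k * real (H k) / d k"
    using growth[of k] d_pos[of k] by (simp add: field_simps)
  then have "8 ^ k * real (H k + e k) / 2 ^ k \<le> W k * real (H k) / d k / 2 ^ k"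
    by (intro divide_right_mono) auto
  moreover have "(8::real) ^ k = 4 ^ k * 2 ^ k" by (simp flip: power_mult_distrib)
  ultimately have "4 ^ k * real (H k + e k) \<le> real (H k) * (W k / (2 ^ k * d k))"
    by (simp add: mult.commute)
  then show ?thesis by (simp add: stay_time_def algebra_simps)
qed

lemma stay_time_ge': "stay_time k \<ge> 4 ^ k - 1"
proof -
  have "(4 ^ k - 1) * 1 \<le> (4 ^ k - 1) * real (H k + e k)"
    using H_pos[of k] by (intro mult_left_mono) auto
  with stay_time_ge[of k] show ?thesis by simp
qed

lemma stay_time_sep: "stay_time k * sep k \<ge> 2 ^ k - 1"
proof -
  have "(4 ^ k - 1) * real (H k + e k) * sep k \<le> stay_time k * sep k"
    by (intro mult_right_mono stay_time_ge) (auto simp: sep_def)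
  moreover have "(4 ^ k - 1) * real (H k + e k) * sep k = (4 ^ k - 1) / 2 ^ k"
    using H_pos[of k] by (simp add: sep_def)
  moreover have "(4::real) ^ k = 2 ^ k * 2 ^ k" by (simp flip: power_mult_distrib)
  then have "(4 ^ k - 1) / 2 ^ k = 2 ^ k - 1 / (2::real) ^ k" by (simp add: field_simps)
  moreover have "1 / (2::real) ^ k \<le> 1" by simp
  ultimately show ?thesis by linarith
qed

section \<open>Borel-Cantelli estimates for late stages\<close>

lemma AE_deep: "AE x in lborel. \<forall>\<^sub>F k in sequentially. x \<in> X k \<longrightarrow> x \<in> deep k"
proof -
  have "AE x in lborel. \<forall>\<^sub>F k in sequentially. x \<notin> X k - deep k"
  proof (rule AE_eventually_notin[where C=1])
    fix k
    show "X k - deep k \<in> sets borel" unfolding deep_def by measurable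
    \<comment> \<open>The excluded strip lies at the end of the level towards which the drift
      points.\<close>
    define a where "a j = (if sg k = 1 then lo k j + W k - W k / 2 ^ k else lo k j)" for j
    have "emeasure lborel (X k - deep k) \<le> ennreal (real (H k) * W k / 2 ^ k)"
    proof (rule emeasure_cover_le[where I="{..<H k}" and a=a and b="\<lambda>j. a j + W k / 2 ^ k"])
      show "X k - deep k \<subseteq> (\<Union>j\<in>{..<H k}. {a j..a j + W k / 2 ^ k})"
      proof
        fix x assume x: "x \<in> X k - deep k"
        then obtain j where j: "j < H k" "x \<in> lev k j" "x + sg k * (W k / 2 ^ k) \<notin> lev k j"
          by (auto simp: X_def deep_def)
        have "0 < W k / 2 ^ k" using W_pos[of k] by simp
        with j sg[of k] have "x \<in> {a j..a j + W k / 2 ^ k}"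
          unfolding a_def lev_def by (elim disjE; simp; linarith)
        with j show "x \<in> (\<Union>j\<in>{..<H k}. {a j..a j + W k / 2 ^ k})" by blast
      qed
    qed (use W_pos[of k] in auto)
    also have "\<dots> \<le> ennreal (1 / 2 ^ k)"
      using HW_le[of k] by (intro ennreal_leI divide_right_mono) auto
    finally show "emeasure lborel (X k - deep k) \<le> ennreal (1 / 2 ^ k)" .
  qed auto
  then show ?thesis by (auto elim!: eventually_mono)
qed

lemma AE_nest: "AE x in lborel. \<forall>\<^sub>F k in sequentially. x \<in> X (Suc k) \<longrightarrow> x \<in> X k"
proof -
  have "AE x in lborel. \<forall>\<^sub>F k in sequentially. x \<notin> X (Suc k) - X k"
  proof (rule AE_eventually_notin[where C=1])
    fix k
    show "X (Suc k) - X k \<in> sets borel" by measurable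
    obtain J where J: "finite J" "card J \<le> e k" "X (Suc k) \<subseteq> X k \<union> (\<Union>j\<in>J. lev (Suc k) j)"
      using nest by blast
    show "emeasure lborel (X (Suc k) - X k) \<le> ennreal (1 / 2 ^ k)"
    proof (rule emeasure_cover_le[where I=J and a="lo (Suc k)" and b="\<lambda>j. lo (Suc k) j + W (Suc k)"])
      show "X (Suc k) - X k \<subseteq> (\<Union>j\<in>J. {lo (Suc k) j..lo (Suc k) j + W (Suc k)})"
        using J(3) by (force simp: lev_def)
      have "real (card J) * W (Suc k) \<le> real (e k) * W (Suc k)"
        using J W_pos[of "Suc k"] by (intro mult_right_mono) auto
      then show "(\<Sum>i\<in>J. lo (Suc k) i + W (Suc k) - lo (Suc k) i) \<le> 1 / 2 ^ k"
        using extra[of k] by simp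
    qed (use J W_pos[of "Suc k"] in auto)
  qed auto
  then show ?thesis by (auto elim!: eventually_mono)
qed

text \<open>A point outside the tower of stage k but close to the next one lies beside one of the
  \<open>2 * H k\<close> ends of levels of stage k, or in an enlarged exceptional level of stage k +
  1. Dividing by \<open>H k + e k\<close> in \<open>sep\<close> keeps the total length of these
  margins below \<open>2 / 2^k\<close>.\<close>

lemma AE_sep:
  "AE y in lborel. \<forall>\<^sub>F k in sequentially. y \<notin> X k \<longrightarrow> (\<forall>z\<in>X (Suc k). sep k \<le> \<bar>z - y\<bar>)"
proof -
  define N where "N k = (\<Union>z\<in>X (Suc k). ball z (sep k)) - X k" for k
  have "AE x in lborel. \<forall>\<^sub>F k in sequentially. x \<notin> N k"
  proof (rule AE_eventually_notin[where C=3])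
    fix k
    have "open (\<Union>z\<in>X (Suc k). ball z (sep k))" by blast
    then show "N k \<in> sets borel" unfolding N_def by (intro sets.Diff borel_open X_meas)
    obtain J where J: "finite J" "card J \<le> e k" "X (Suc k) \<subseteq> X k \<union> (\<Union>j\<in>J. lev (Suc k) j)"
      using nest by blast
    let ?r = "sep k" and ?V = "W (Suc k)"
    have r: "?r > 0" using H_pos[of k] by (simp add: sep_def)
    \<comment> \<open>Three families of intervals: the left margins of the levels, their right
      margins, and the exceptional levels with a margin on both sides.\<close>
    define I where "I = {..<H k} <+> ({..<H k} <+> J)"
    define a where "a = case_sum (\<lambda>j. lo k j - ?r) (case_sum (\<lambda>j. lo k j + W k) (\<lambda>j. lo (Suc k) j - ?r))"
    define b where "b = case_sum (\<lambda>j. lo k j) (case_sum (\<lambda>j. lo k j + W k + ?r) (\<lambda>j. lo (Suc k) j + ?V + ?r))"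
    show "emeasure lborel (N k) \<le> ennreal (3 / 2 ^ k)"
    proof (rule emeasure_cover_le[where I=I and a=a and b=b])
      show "finite I" using J by (simp add: I_def)
      show "a i \<le> b i" if "i \<in> I" for i
        using r W_pos[of "Suc k"] W_pos[of k] by (auto simp: a_def b_def split: sum.splits)
      show "N k \<subseteq> (\<Union>i\<in>I. {a i..b i})"
      proof
        fix y assume "y \<in> N k"
        then obtain z where z: "z \<in> X (Suc k)" "\<bar>z - y\<bar> < ?r" and y: "y \<notin> X k"
          by (auto simp: N_def dist_real_def)
        from J(3) z(1) consider "z \<in> X k" | j where "j \<in> J" "z \<in> lev (Suc k) j" by auto
        then show "y \<in> (\<Union>i\<in>I. {a i..b i})"
        proof cases
          case 1
          then obtain j where j: "j < H k" "z \<in> lev k j" by (auto simp: X_def)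
          with y have "y \<notin> lev k j" by (auto simp: X_def)
          then have "y \<in> {lo k j - ?r..lo k j} \<or> y \<in> {lo k j + W k..lo k j + W k + ?r}"
            using j z(2) by (auto simp: lev_def)
          then show ?thesis
          proof
            assume "y \<in> {lo k j - ?r..lo k j}"
            then show ?thesis using j by (intro UN_I[of "Inl j"]) (auto simp: I_def a_def b_def)
          next
            assume "y \<in> {lo k j + W k..lo k j + W k + ?r}"
            then show ?thesis using j by (intro UN_I[of "Inr (Inl j)"]) (auto simp: I_def a_def b_def)
          qed
        next
          case 2
          then show ?thesis using z(2)
            by (intro UN_I[of "Inr (Inr j)"]) (auto simp: I_def a_def b_def lev_def)
        qed
      qed
      have "(\<Sum>i\<in>I. b i - a i) = 2 * real (H k) * ?r + real (card J) * (?V + 2 * ?r)"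
        using J by (simp add: I_def sum.Plus a_def b_def)
      also have "\<dots> \<le> 2 * real (H k) * ?r + real (e k) * (?V + 2 * ?r)"
        using J r W_pos[of "Suc k"] by (intro add_left_mono mult_right_mono) auto
      also have "\<dots> = 2 * (real (H k + e k) * ?r) + real (e k) * ?V" by (simp add: algebra_simps)
      also have "real (H k + e k) * ?r = 1 / 2 ^ k" using H_pos[of k] by (simp add: sep_def)
      also have "2 * (1 / 2 ^ k) + real (e k) * ?V \<le> 3 / 2 ^ k" using extra[of k] by simp
      finally show "(\<Sum>i\<in>I. b i - a i) \<le> 3 / 2 ^ k" .
    qed
  qed auto
  then show ?thesis
    by (rule AE_mp) (intro AE_I2 impI, erule eventually_mono, force simp: N_def dist_real_def)
qed

text \<open>The drift carries a point of \<open>start \<epsilon> k i\<close> past a point of \<open>ahead \<epsilon> k j\<close> within an \<open>\<epsilon>\<close>-fraction of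
  the \<open>W k / d k\<close> passes through the tower.\<close>
definition start :: "real \<Rightarrow> nat \<Rightarrow> nat \<Rightarrow> real set" where
  "start \<epsilon> k j = (let w = \<epsilon> * W k in
     if sg k = 1 then {lo k j<..<lo k j + w / 4} else {lo k j + W k - w / 4<..<lo k j + W k})"

definition ahead :: "real \<Rightarrow> nat \<Rightarrow> nat \<Rightarrow> real set" where
  "ahead \<epsilon> k j = (let w = \<epsilon> * W k in
     if sg k = 1 then {lo k j + w / 2<..<lo k j + w} else {lo k j + W k - w<..<lo k j + W k - w / 2})"

lemma start_subset: "0 < \<epsilon> \<Longrightarrow> \<epsilon> \<le> 1 \<Longrightarrow> start \<epsilon> k j \<subseteq> lev k j"
  and ahead_subset: "0 < \<epsilon> \<Longrightarrow> \<epsilon> \<le> 1 \<Longrightarrow> ahead \<epsilon> k j \<subseteq> lev k j"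
proof -
  assume "0 < \<epsilon>" "\<epsilon> \<le> 1"
  then have "0 < \<epsilon> * W k" "\<epsilon> * W k \<le> W k"
    using W_pos[of k] by (auto simp: mult_left_le_one_le)
  then show "start \<epsilon> k j \<subseteq> lev k j" "ahead \<epsilon> k j \<subseteq> lev k j"
    by (auto simp: start_def ahead_def lev_def Let_def)
qed

lemma start_ahead_meas [measurable]: "start \<epsilon> k j \<in> sets borel" "ahead \<epsilon> k j \<in> sets borel"
  by (auto simp: start_def ahead_def Let_def)

lemma emeasure_start_ahead:
  assumes "0 < \<epsilon>"
  shows "emeasure lborel (start \<epsilon> k j) = ennreal (\<epsilon> * W k / 4)"
    "emeasure lborel (ahead \<epsilon> k j) = ennreal (\<epsilon> * W k / 2)"
proof -
  have "0 < \<epsilon> * W k" using assms W_pos[of k] by simp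
  then show "emeasure lborel (start \<epsilon> k j) = ennreal (\<epsilon> * W k / 4)"
    "emeasure lborel (ahead \<epsilon> k j) = ennreal (\<epsilon> * W k / 2)"
    by (auto simp: start_def ahead_def Let_def)
qed

text \<open>Each pass through the tower reduces the offset \<open>D\<close> between the two points
  by \<open>d k\<close>. Rounding \<open>D / d k\<close> down leaves a distance of at most
  \<open>d k\<close> at a time of about \<open>D / d k * H k\<close>, and the product is about
  \<open>D * H k \<le> \<epsilon> * (H k * W k) \<le> \<epsilon>\<close>. The lower bound on the
  time makes different stages yield arbitrarily large times.\<close>

lemma close_approach:
  assumes \<epsilon>: "0 < \<epsilon>" "\<epsilon> \<le> 1" "4 \<le> \<epsilon> * 8 ^ k"
    and i: "i < H k" "x \<in> start \<epsilon> k i" and j: "j < H k" "y \<in> ahead \<epsilon> k j"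
  obtains n where "\<epsilon> * 8 ^ k / 4 - 2 \<le> real n" "real n * \<bar>(T ^^ n) x - y\<bar> \<le> \<epsilon> + 1 / 8 ^ k"
proof -
  define D where "D = sg k * ((y - lo k j) - (x - lo k i))"
  define q where "q = nat \<lfloor>D / d k\<rfloor>"
  define n where "n = q * H k + j - i"
  have w: "0 < \<epsilon> * W k" using \<epsilon> W_pos[of k] by simp
  have D: "\<epsilon> * W k / 4 \<le> D" "D \<le> \<epsilon> * W k"
    using i j w sg[of k] by (auto simp: start_def ahead_def D_def Let_def)
  have xl: "x \<in> lev k i" and yl: "y \<in> lev k j" using start_subset ahead_subset \<epsilon> i j by blast+
  have d: "0 < d k" by (rule d_pos)
  have "8 ^ k * real (H k) * d k \<le> 8 ^ k * real (H k + e k) * d k"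
    using d by (intro mult_right_mono mult_left_mono) auto
  also have "\<dots> \<le> W k * real (H k)" by (rule growth)
  finally have Wd: "8 ^ k * d k \<le> W k" using H_pos[of k] by (simp add: algebra_simps)
  have "\<epsilon> * 8 ^ k / 4 * d k = \<epsilon> * (8 ^ k * d k) / 4" by simp
  also have "\<dots> \<le> \<epsilon> * W k / 4" using \<epsilon> Wd by (intro divide_right_mono mult_left_mono) auto
  also have "\<dots> \<le> D" by (rule D)
  finally have Dd: "\<epsilon> * 8 ^ k / 4 \<le> D / d k" using d by (simp add: pos_le_divide_eq)
  have q: "real q \<le> D / d k" "D / d k < real q + 1"
    using Dd \<epsilon>(3) unfolding q_def by linarith+
  \<comment> \<open>At least one full pass is made, so the subtraction of natural numbers in
    \<open>n\<close> is not truncated.\<close>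
  have q1: "1 \<le> q" using q Dd \<epsilon>(3) by linarith
  have qH: "H k \<le> q * H k" using q1 by simp
  have "i \<le> q * H k" using i qH by linarith
  then have "i + n = j + q * H k" by (simp add: n_def)
  then have dm: "(i + n) div H k = q" "(i + n) mod H k = j"
    using j H_pos[of k] by simp_all
  have dq: "d k * real q \<le> D" "D < d k * real q + d k" using q d by (auto simp: field_simps)
  have yD: "y = x + (lo k j - lo k i) + sg k * D" using sg[of k] by (auto simp: D_def)
  have "x + sg k * D \<in> lev k i" using yl yD by (auto simp: lev_def)
  then have "x + sg k * (d k * real q) \<in> lev k i"
    using dq(1) d by (subst lev_between[OF xl, of D]) simp_all
  then have "(T ^^ n) x = x + (lo k j - lo k i) + sg k * (d k * real q)"
    using funpow_lev[OF i(1) xl, of n] dm by simp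
  then have "(T ^^ n) x - y = sg k * (d k * real q - D)" by (simp add: yD algebra_simps)
  then have "\<bar>(T ^^ n) x - y\<bar> = D - d k * real q" using sg[of k] dq by auto
  then have dist: "\<bar>(T ^^ n) x - y\<bar> \<le> d k" using dq by simp
  have nle: "real n \<le> (D / d k + 1) * real (H k)"
  proof -
    have "n \<le> (q + 1) * H k" using j by (simp add: n_def)
    then have "real n \<le> (real q + 1) * real (H k)" by (metis of_nat_1 of_nat_add of_nat_le_iff of_nat_mult)
    also have "\<dots> \<le> (D / d k + 1) * real (H k)" using q by (intro mult_right_mono) auto
    finally show ?thesis .
  qed
  have "real n * \<bar>(T ^^ n) x - y\<bar> \<le> (D / d k + 1) * real (H k) * d k"
    using nle dist d q by (intro mult_mono) auto
  also have "\<dots> = D * real (H k) + d k * real (H k)" using d by (simp add: field_simps)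
  also have "\<dots> \<le> \<epsilon> + 1 / 8 ^ k"
  proof (rule add_mono)
    have "D * real (H k) \<le> \<epsilon> * W k * real (H k)" using D by (intro mult_right_mono) auto
    also have "\<dots> = \<epsilon> * (real (H k) * W k)" by simp
    also have "\<dots> \<le> \<epsilon> * 1" using HW_le[of k] \<epsilon> by (intro mult_left_mono) auto
    finally show "D * real (H k) \<le> \<epsilon>" by simp
    have "d k * real (H k) \<le> d k * real (H k + e k)" using d by (intro mult_left_mono) auto
    then show "d k * real (H k) \<le> 1 / 8 ^ k" using dH_le[of k] by linarith
  qed
  finally have 1: "real n * \<bar>(T ^^ n) x - y\<bar> \<le> \<epsilon> + 1 / 8 ^ k" .
  have "q * H k - H k \<le> n" using i by (simp add: n_def)
  moreover have "(q - 1) * 1 \<le> (q - 1) * H k" using H_pos[of k] by (intro mult_left_mono) auto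
  ultimately have "q - 1 \<le> n" by (simp add: diff_mult_distrib)
  then have "\<epsilon> * 8 ^ k / 4 - 2 \<le> real n" using q Dd q1 by linarith
  from that[OF this 1] show thesis .
qed

lemma phi1_le:
  assumes \<epsilon>: "0 < \<epsilon>" "\<epsilon> \<le> 1"
    and freq: "\<exists>\<^sub>F k in sequentially. \<exists>i<H k. \<exists>j<H k. x \<in> start \<epsilon> k i \<and> y \<in> ahead \<epsilon> k j"
  shows "phi1 T x y \<le> ereal (2 * \<epsilon>)"
proof (rule ccontr)
  assume "\<not> ?thesis"
  then have "ereal (2 * \<epsilon>) < liminf (\<lambda>n. ereal (real n * \<bar>(T ^^ n) x - y\<bar>))" by (simp add: phi1_def)
  from less_LiminfD[OF this] obtain N where N: "\<And>n. N \<le> n \<Longrightarrow> 2 * \<epsilon> < real n * \<bar>(T ^^ n) x - y\<bar>"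
    by (auto simp: eventually_sequentially)
  have "filterlim (\<lambda>k. \<epsilon> * 8 ^ k / 4 - 2 :: real) at_top sequentially" using \<epsilon> by real_asymp
  then have "\<forall>\<^sub>F k in sequentially. max (real N) 4 \<le> \<epsilon> * 8 ^ k / 4 - 2"
    unfolding filterlim_at_top by blast
  moreover have "(\<lambda>k. 1 / 8 ^ k :: real) \<longlonglongrightarrow> 0" by real_asymp
  then have "\<forall>\<^sub>F k in sequentially. 1 / 8 ^ k < \<epsilon>" using \<epsilon>(1) by (rule order_tendstoD)
  ultimately have "\<forall>\<^sub>F k in sequentially. \<epsilon> * 8 ^ k / 4 - 2 \<ge> max (real N) 4 \<and> 1 / 8 ^ k < \<epsilon>"
    by eventually_elim auto
  from frequently_eventually_conj[OF freq this] have "\<exists>\<^sub>F k in sequentially. False"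
  proof (rule frequently_elim1)
    fix k assume *: "(max (real N) 4 \<le> \<epsilon> * 8 ^ k / 4 - 2 \<and> 1 / 8 ^ k < \<epsilon>) \<and>
       (\<exists>i<H k. \<exists>j<H k. x \<in> start \<epsilon> k i \<and> y \<in> ahead \<epsilon> k j)"
    then obtain i j where ij: "i < H k" "x \<in> start \<epsilon> k i" "j < H k" "y \<in> ahead \<epsilon> k j" by blast
    have "4 \<le> \<epsilon> * 8 ^ k" using * by (auto simp: max_def split: if_splits)
    from close_approach[OF \<epsilon> this ij] obtain n
      where n: "\<epsilon> * 8 ^ k / 4 - 2 \<le> real n" "real n * \<bar>(T ^^ n) x - y\<bar> \<le> \<epsilon> + 1 / 8 ^ k" .
    have "N \<le> n" using n * by linarith
    from N[OF this] n(2) * show False by linarith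
  qed
  then show False by simp
qed

text \<open>The bad set is contained in a union of small squares \<open>lev k i \<times> lev k j\<close> which hardly exceeds it, but
  each square loses the fixed proportion \<open>c\<close> to \<open>start \<epsilon> k i \<times> ahead \<epsilon> k j\<close>.\<close>
lemma AE_start_ahead:
  assumes \<epsilon>: "0 < \<epsilon>" "\<epsilon> \<le> 1"
  shows "AE p in lborel \<Otimes>\<^sub>M lborel. (\<forall>\<^sub>F k in sequentially. fst p \<in> X k \<and> snd p \<in> X k) \<longrightarrow>
    (\<exists>\<^sub>F k in sequentially. \<exists>i<H k. \<exists>j<H k. fst p \<in> start \<epsilon> k i \<and> snd p \<in> ahead \<epsilon> k j)"
proof -
  define E where "E k = (\<Union>i<H k. start \<epsilon> k i) \<times> (\<Union>j<H k. ahead \<epsilon> k j)" for k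
  \<comment> \<open>The exceptional pairs form the union of these sets over \<open>K\<close>. Levels
    of successive stages are not assumed to be nested, so each \<open>F K\<close> is shown to be
    null by outer and inner approximation rather than by a density theorem for a filtration.\<close>
  define F where "F K = (\<Inter>k\<in>{K..}. X k \<times> X k - E k)" for K
  have E_meas [measurable]: "E k \<in> sets (borel \<Otimes>\<^sub>M borel)" for k unfolding E_def by measurable
  have F_meas [measurable]: "F K \<in> sets (borel \<Otimes>\<^sub>M borel)" for K unfolding F_def by measurable
  have F_lborel: "F K \<in> sets lborel" for K using F_meas[of K] unfolding borel_prod by simp
  \<comment> \<open>\<open>start\<close> and \<open>ahead\<close> take the fractions
    \<open>\<epsilon> / 4\<close> and \<open>\<epsilon> / 2\<close> of the width of a level.\<close>
  define c where "c = \<epsilon>\<^sup>2 / 8"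
  have c: "0 < c" using \<epsilon> by (simp add: c_def)
  have F_bounded: "bounded (F K)" for K
  proof (rule bounded_subset)
    show "bounded ({0..1} \<times> {0..1} :: (real \<times> real) set)"
      by (intro bounded_Times bounded_closed_interval)
    show "F K \<subseteq> {0..1} \<times> {0..1}" using X_subset[of K] by (force simp: F_def)
  qed
  have small: "c * measure lborel (F K) \<le> (1 + c) * \<eta>" if \<eta>: "0 < \<eta>" for K \<eta>
  proof -
    have FL: "F K \<in> sets lebesgue" using F_lborel[of K] by (simp add: sets_completionI_sets)
    obtain U where U: "open U" "F K \<subseteq> U" "U - F K \<in> lmeasurable" "emeasure lebesgue (U - F K) < ennreal \<eta>"
      using sets_lebesgue_outer_open[OF FL \<eta>] by blast
    obtain C where C: "closed C" "C \<subseteq> F K" "F K - C \<in> lmeasurable" "emeasure lebesgue (F K - C) < ennreal \<eta>"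
      using sets_lebesgue_inner_closed[OF FL \<eta>] by blast
    have "bounded C" using C(2) F_bounded by (rule bounded_subset[rotated])
    then have "compact C" using C(1) by (simp add: compact_eq_bounded_closed)
    moreover have "closed (- U)" using U by auto
    moreover have "C \<inter> - U = {}" using C U by auto
    ultimately obtain \<delta> where \<delta>: "0 < \<delta>" "\<And>p q. p \<in> C \<Longrightarrow> q \<in> - U \<Longrightarrow> \<delta> \<le> dist p q"
      using separate_compact_closed by (metis (no_types, lifting))
    \<comment> \<open>Two points of a square of stage k are less than \<open>2 * W k\<close> apart,
      so a square that meets \<open>C\<close> cannot leave \<open>U\<close>.\<close>
    obtain k where k: "K \<le> k" "2 * W k < \<delta>"
    proof -
      have "(\<lambda>k. 2 * (1 / 2 ^ k) :: real) \<longlonglongrightarrow> 0" by real_asymp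
      from order_tendstoD(2)[OF this \<delta>(1)] have "\<forall>\<^sub>F k in sequentially. K \<le> k \<and> 2 * (1 / 2 ^ k) < \<delta>"
        by (auto intro: eventually_conj eventually_ge_at_top)
      then obtain k where "K \<le> k" "2 * (1 / 2 ^ k) < \<delta>" by (auto simp: eventually_sequentially)
      with W_small[of k] that[of k] show ?thesis by linarith
    qed
    define Q where "Q = {(i, j). i < H k \<and> j < H k \<and> C \<inter> lev k i \<times> lev k j \<noteq> {}}"
    have "Q \<subseteq> {..<H k} \<times> {..<H k}" by (auto simp: Q_def)
    then have Q_fin: "finite Q" by (rule finite_subset) auto
    have C_sub: "C \<subseteq> (\<Union>(i,j)\<in>Q. lev k i \<times> lev k j)"
    proof
      fix p assume p: "p \<in> C"
      then have "p \<in> X k \<times> X k" using C(2) k(1) by (auto simp: F_def)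
      then obtain i j where "i < H k" "j < H k" "p \<in> lev k i \<times> lev k j" by (auto simp: X_def)
      with p show "p \<in> (\<Union>(i,j)\<in>Q. lev k i \<times> lev k j)" by (intro UN_I[of "(i,j)"]) (auto simp: Q_def)
    qed
    have QU: "lev k i \<times> lev k j \<subseteq> U" if ij: "(i, j) \<in> Q" for i j
    proof
      fix q assume q: "q \<in> lev k i \<times> lev k j"
      obtain p where p: "p \<in> C" "p \<in> lev k i \<times> lev k j" using ij by (auto simp: Q_def)
      have "dist p q \<le> dist (fst p) (fst q) + dist (snd p) (snd q)"
        using norm_Pair_le[of "fst p - fst q" "snd p - snd q"]
        by (cases p; cases q) (simp add: dist_norm)
      also have "\<dots> < 2 * W k" using p(2) q by (auto simp: lev_def dist_real_def)
      finally have "dist p q < \<delta>" using k(2) by simp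
      with \<delta>(2)[OF p(1), of q] show "q \<in> U" by force
    qed
    have dsj: "disjoint_family_on (\<lambda>(i,j). start \<epsilon> k i \<times> ahead \<epsilon> k j) Q"
      unfolding disjoint_family_on_def
    proof (intro ballI impI)
      fix a b assume ab: "a \<in> Q" "b \<in> Q" "a \<noteq> b"
      obtain i j i' j' where ij: "a = (i, j)" "b = (i', j')" by (cases a; cases b)
      then have "lev k i \<inter> lev k i' = {} \<or> lev k j \<inter> lev k j' = {}"
        using disjoint[of i k i'] disjoint[of j k j'] ab by (auto simp: Q_def)
      then show "(case a of (i, j) \<Rightarrow> start \<epsilon> k i \<times> ahead \<epsilon> k j) \<inter>
          (case b of (i, j) \<Rightarrow> start \<epsilon> k i \<times> ahead \<epsilon> k j) = {}"
        using start_subset[OF \<epsilon>, of k] ahead_subset[OF \<epsilon>, of k] unfolding ij prod.case by blast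
    qed
    have meas: "start \<epsilon> k i \<times> ahead \<epsilon> k j \<in> sets (lborel \<Otimes>\<^sub>M lborel)"
      "lev k i \<times> lev k j \<in> sets (lborel \<Otimes>\<^sub>M lborel)" for i j
      by (intro pair_measureI; simp add: start_ahead_meas X_meas)+
    \<comment> \<open>The parts removed from the squares lie in \<open>U - F K\<close>, whose
      measure is below \<open>\<eta>\<close>. This bounds the number of squares and hence the
      measure of \<open>C\<close>.\<close>
    define S where "S = (\<Union>(i,j)\<in>Q. start \<epsilon> k i \<times> ahead \<epsilon> k j)"
    have "S \<in> sets (lborel \<Otimes>\<^sub>M lborel)"
      unfolding S_def using meas by (intro sets.finite_UN Q_fin) (auto split: prod.split)
    then have S_lborel: "S \<in> sets lborel" by (simp only: lborel_prod)
    have W0: "0 \<le> W k" using W_pos[of k] by simp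
    have "ennreal (real (card Q) * (c * (W k)\<^sup>2)) = (\<Sum>(i,j)\<in>Q. emeasure (lborel \<Otimes>\<^sub>M lborel) (start \<epsilon> k i \<times> ahead \<epsilon> k j))"
    proof -
      have "emeasure (lborel \<Otimes>\<^sub>M lborel) (start \<epsilon> k i \<times> ahead \<epsilon> k j) = ennreal (c * (W k)\<^sup>2)" for i j
        using \<epsilon> W0
        by (simp add: lborel.emeasure_pair_measure_Times emeasure_start_ahead ennreal_mult[symmetric])
          (simp add: c_def power2_eq_square)
      then show ?thesis using c by (simp add: case_prod_beta ennreal_mult ennreal_of_nat_eq_real_of_nat)
    qed
    also have "\<dots> = emeasure (lborel \<Otimes>\<^sub>M lborel) S"
    proof -
      have "(\<lambda>(i,j). start \<epsilon> k i \<times> ahead \<epsilon> k j) ` Q \<subseteq> sets (lborel \<Otimes>\<^sub>M lborel)"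
        using meas by (auto split: prod.split)
      from sum_emeasure[OF this dsj Q_fin] show ?thesis unfolding S_def by (simp only: case_prod_unfold)
    qed
    also have "\<dots> = emeasure lebesgue S"
      using S_lborel unfolding lborel_prod by simp
    also have "\<dots> \<le> emeasure lebesgue (U - F K)"
    proof (rule emeasure_mono)
      show "S \<subseteq> U - F K"
        unfolding S_def
      proof safe
        fix a b i j assume ij: "(i, j) \<in> Q" "a \<in> start \<epsilon> k i" "b \<in> ahead \<epsilon> k j"
        then show "(a, b) \<in> U" using QU[OF ij(1)] start_subset[OF \<epsilon>, of k i] ahead_subset[OF \<epsilon>, of k j] by blast
        have "(a, b) \<in> E k" using ij by (auto simp: E_def Q_def)
        then show "(a, b) \<in> F K \<Longrightarrow> False" using k(1) by (auto simp: F_def)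
      qed
    qed (use U in auto)
    also have "\<dots> < ennreal \<eta>" by (rule U)
    finally have 1: "real (card Q) * (c * (W k)\<^sup>2) \<le> \<eta>" using \<eta> by (simp add: ennreal_less_iff c less_imp_le)
    have "emeasure lborel C \<le> emeasure (lborel \<Otimes>\<^sub>M lborel) (\<Union>(i,j)\<in>Q. lev k i \<times> lev k j)"
      unfolding lborel_prod[symmetric]
      by (intro emeasure_mono C_sub sets.finite_UN Q_fin) (use meas in \<open>auto split: prod.split\<close>)
    also have "\<dots> \<le> (\<Sum>(i,j)\<in>Q. emeasure (lborel \<Otimes>\<^sub>M lborel) (lev k i \<times> lev k j))"
    proof -
      have "(\<lambda>(i,j). lev k i \<times> lev k j) ` Q \<subseteq> sets (lborel \<Otimes>\<^sub>M lborel)"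
        using meas by (auto split: prod.split)
      from emeasure_subadditive_finite[OF Q_fin this] show ?thesis by (simp only: case_prod_unfold)
    qed
    also have "\<dots> = ennreal (real (card Q) * (W k)\<^sup>2)"
    proof -
      have "emeasure (lborel \<Otimes>\<^sub>M lborel) (lev k i \<times> lev k j) = ennreal ((W k)\<^sup>2)" for i j
        using W0 unfolding lev_def
        by (simp add: lborel.emeasure_pair_measure_Times ennreal_mult[symmetric] power2_eq_square)
      then show ?thesis by (simp add: case_prod_beta ennreal_mult ennreal_of_nat_eq_real_of_nat)
    qed
    finally have 2: "emeasure lborel C \<le> ennreal (real (card Q) * (W k)\<^sup>2)" .
    have "emeasure lebesgue (F K) \<le> emeasure lebesgue C + emeasure lebesgue (F K - C)"
      using C FL by (subst plus_emeasure) (auto simp: Un_absorb1)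
    also have "\<dots> \<le> ennreal (real (card Q) * (W k)\<^sup>2) + ennreal \<eta>"
      using 2 C by (intro add_mono) (auto simp: less_imp_le)
    finally have "emeasure lborel (F K) \<le> ennreal (real (card Q) * (W k)\<^sup>2 + \<eta>)"
      using \<eta> F_lborel[of K] by (simp add: ennreal_plus)
    then have "measure lborel (F K) \<le> real (card Q) * (W k)\<^sup>2 + \<eta>"
      using \<eta> by (simp add: measure_def enn2real_leI)
    then have "c * measure lborel (F K) \<le> c * (real (card Q) * (W k)\<^sup>2 + \<eta>)" using c by simp
    with 1 show ?thesis by (simp add: algebra_simps)
  qed
  have "F K \<in> null_sets (lborel \<Otimes>\<^sub>M lborel)" for K
  proof -
    have "c * measure lborel (F K) \<le> 0"
    proof (rule field_le_epsilon)
      fix \<eta> :: real assume "0 < \<eta>"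
      then show "c * measure lborel (F K) \<le> 0 + \<eta>" using small[of "\<eta> / (1 + c)" K] c by simp
    qed
    then have "measure lborel (F K) = 0" using c by (simp add: mult_le_0_iff measure_le_0_iff)
    moreover have "emeasure lborel (F K) < \<infinity>" using F_bounded by (rule emeasure_bounded_finite)
    ultimately have "emeasure lborel (F K) = 0" by (simp add: emeasure_eq_ennreal_measure)
    then show ?thesis by (simp add: null_sets_def lborel_prod F_lborel[simplified])
  qed
  then have "AE p in lborel \<Otimes>\<^sub>M lborel. p \<notin> F K" for K by (rule AE_not_in)
  then have "AE p in lborel \<Otimes>\<^sub>M lborel. \<forall>K. p \<notin> F K" by (simp add: AE_all_countable)
  then show ?thesis
  proof (rule AE_mp, intro AE_I2 impI)
    fix p assume p: "\<forall>K. p \<notin> F K" "\<forall>\<^sub>F k in sequentially. fst p \<in> X k \<and> snd p \<in> X k"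
    then obtain K where K: "\<And>k. K \<le> k \<Longrightarrow> fst p \<in> X k \<and> snd p \<in> X k" by (auto simp: eventually_sequentially)
    show "\<exists>\<^sub>F k in sequentially. \<exists>i<H k. \<exists>j<H k. fst p \<in> start \<epsilon> k i \<and> snd p \<in> ahead \<epsilon> k j"
      unfolding frequently_sequentially
    proof
      fix N
      have "p \<notin> F (max N K)" using p by blast
      then obtain k where k: "max N K \<le> k" "p \<notin> X k \<times> X k - E k" by (auto simp: F_def)
      then have "p \<in> E k" using K[of k] by (auto simp: mem_Times_iff)
      with k show "\<exists>k\<ge>N. \<exists>i<H k. \<exists>j<H k. fst p \<in> start \<epsilon> k i \<and> snd p \<in> ahead \<epsilon> k j"
        by (intro exI[of _ k]) (auto simp: E_def; blast)
    qed
  qed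
qed

lemma AE_phi1_zero:
  "AE p in lborel \<Otimes>\<^sub>M lborel. (\<forall>\<^sub>F k in sequentially. fst p \<in> X k \<and> snd p \<in> X k) \<longrightarrow>
    phi1 T (fst p) (snd p) = 0"
proof -
  have "AE p in lborel \<Otimes>\<^sub>M lborel. (\<forall>\<^sub>F k in sequentially. fst p \<in> X k \<and> snd p \<in> X k) \<longrightarrow>
    phi1 T (fst p) (snd p) \<le> ereal (2 * (1 / real (Suc m)))" for m
  proof -
    have \<epsilon>: "0 < 1 / real (Suc m)" "1 / real (Suc m) \<le> 1" by auto
    show ?thesis by (rule AE_mp[OF AE_start_ahead[OF \<epsilon>]]) (intro AE_I2 impI phi1_le[OF \<epsilon>], blast)
  qed
  then have "AE p in lborel \<Otimes>\<^sub>M lborel. \<forall>m. (\<forall>\<^sub>F k in sequentially. fst p \<in> X k \<and> snd p \<in> X k) \<longrightarrow>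
    phi1 T (fst p) (snd p) \<le> ereal (2 * (1 / real (Suc m)))" unfolding AE_all_countable by blast
  then show ?thesis
  proof (rule AE_mp, intro AE_I2 impI)
    fix p assume "\<forall>m. (\<forall>\<^sub>F k in sequentially. fst p \<in> X k \<and> snd p \<in> X k) \<longrightarrow>
      phi1 T (fst p) (snd p) \<le> ereal (2 * (1 / real (Suc m)))"
      "\<forall>\<^sub>F k in sequentially. fst p \<in> X k \<and> snd p \<in> X k"
    then have le: "phi1 T (fst p) (snd p) \<le> ereal (2 * (1 / real (Suc m)))" for m by blast
    have "(\<lambda>m. ereal (2 * (1 / real (Suc m)))) \<longlonglongrightarrow> ereal 0"
      unfolding lim_ereal by real_asymp
    then have "phi1 T (fst p) (snd p) \<le> ereal 0" by (rule LIMSEQ_le_const) (use le in blast)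
    moreover have "0 \<le> phi1 T (fst p) (snd p)" unfolding phi1_def by (intro Liminf_bounded) auto
    ultimately show "phi1 T (fst p) (snd p) = 0" by (simp add: zero_ereal_def)
  qed
qed

section \<open>Divergence between a tower and its complement\<close>

definition generic_x :: "real \<Rightarrow> bool" where
  "generic_x x \<longleftrightarrow> (\<forall>\<^sub>F k in sequentially. x \<in> X k \<longrightarrow> x \<in> deep k)"

definition generic_y :: "real \<Rightarrow> bool" where
  "generic_y y \<longleftrightarrow> (\<forall>\<^sub>F k in sequentially. y \<notin> X k \<longrightarrow> (\<forall>z\<in>X (Suc k). sep k \<le> \<bar>z - y\<bar>))"

lemma AE_generic: "AE x in lborel. generic_x x" "AE y in lborel. generic_y y"
  unfolding generic_x_def generic_y_def by (rule AE_deep AE_sep)+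

text \<open>Every large time n gets a stage k with \<open>stay_time k < n\<close> and
  \<open>n \<le> stay_time (Suc k)\<close>. The upper bound keeps the orbit in the tower of stage k
  + 1, from which y has distance at least \<open>sep k\<close>; the lower bound turns this distance
  into a large product.\<close>

lemma phi1_infinite:
  assumes "generic_x x" "generic_y y"
    and x: "\<forall>\<^sub>F k in sequentially. x \<in> X k" and y: "\<forall>\<^sub>F k in sequentially. y \<notin> X k"
  shows "phi1 T x y = \<infinity>"
proof -
  have ev: "\<forall>\<^sub>F k in sequentially. x \<in> deep k \<and> (\<forall>z\<in>X (Suc k). sep k \<le> \<bar>z - y\<bar>)"
    using assms unfolding generic_x_def generic_y_def by eventually_elim auto
  have "(\<lambda>n. ereal (real n * \<bar>(T ^^ n) x - y\<bar>)) \<longlonglongrightarrow> \<infinity>"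
    unfolding tendsto_PInfty
  proof
    fix C :: real
    have "filterlim (\<lambda>k. 2 ^ k - 1 :: real) at_top sequentially" by real_asymp
    then have "\<forall>\<^sub>F k in sequentially. C + 1 \<le> 2 ^ k - 1"
      unfolding filterlim_at_top by blast
    with ev have "\<forall>\<^sub>F k in sequentially. C + 1 \<le> 2 ^ k - 1 \<and> x \<in> deep k \<and> (\<forall>z\<in>X (Suc k). sep k \<le> \<bar>z - y\<bar>)"
      by eventually_elim auto
    then obtain K where K: "\<And>k. K \<le> k \<Longrightarrow> C + 1 \<le> 2 ^ k - 1" "\<And>k. K \<le> k \<Longrightarrow> x \<in> deep k"
      "\<And>k z. K \<le> k \<Longrightarrow> z \<in> X (Suc k) \<Longrightarrow> sep k \<le> \<bar>z - y\<bar>"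
      by (auto simp: eventually_sequentially)
    have large: "C < real n * \<bar>(T ^^ n) x - y\<bar>" if n: "stay_time K < real n" for n
    proof -
      have "filterlim (\<lambda>k. 4 ^ k - 1 :: real) at_top sequentially" by real_asymp
      then have "\<forall>\<^sub>F k in sequentially. real n \<le> 4 ^ k - 1"
        unfolding filterlim_at_top by blast
      then obtain L where "K \<le> L" "real n \<le> 4 ^ L - 1"
        by (metis eventually_sequentially max.cobounded1 max.cobounded2)
      then have L: "K \<le> L" "real n \<le> stay_time L" using stay_time_ge'[of L] by auto
      \<comment> \<open>\<open>stay_time\<close> is not known to be monotone. Without such a stage,
        n would exceed \<open>stay_time k\<close> for all \<open>k \<ge> K\<close>, contrary to the
        choice of \<open>L\<close>.\<close>
      have "\<exists>k. K \<le> k \<and> stay_time k < real n \<and> real n \<le> stay_time (Suc k)"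
      proof (rule ccontr)
        assume *: "\<not> ?thesis"
        have "stay_time k < real n" if "K \<le> k" for k
          using that by (induction k rule: dec_induct) (use n * in force)+
        with L show False by force
      qed
      then obtain k where k: "K \<le> k" "stay_time k < real n" "real n \<le> stay_time (Suc k)" by blast
      have "(T ^^ n) x \<in> X (Suc k)" using k K(2)[of "Suc k"] by (intro stay) auto
      then have "sep k \<le> \<bar>(T ^^ n) x - y\<bar>" using K(3) k by blast
      moreover have "0 < sep k" using H_pos[of k] by (simp add: sep_def)
      ultimately have "stay_time k * sep k \<le> real n * \<bar>(T ^^ n) x - y\<bar>"
        using k by (intro mult_mono) auto
      then show ?thesis using stay_time_sep[of k] K(1)[OF k(1)] by linarith
    qed
    have "\<forall>\<^sub>F n in sequentially. stay_time K < real n"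
      using filterlim_real_sequentially unfolding filterlim_at_top_dense by blast
    then show "\<forall>\<^sub>F n in sequentially. ereal C < ereal (real n * \<bar>(T ^^ n) x - y\<bar>)"
      by eventually_elim (simp add: large)
  qed
  then show ?thesis unfolding phi1_def by (rule lim_imp_Liminf[rotated]) simp
qed

end

section \<open>Two complementary towers\<close>

lemma space_lambda01 [simp]: "space lambda01 = {0..<1}"
  by (simp add: lambda01_def space_restrict_space)

interpretation lambda01: prob_space lambda01
  by (intro prob_spaceI) (simp add: lambda01_def space_restrict_space emeasure_restrict_space)

interpretation lambda01_pair: pair_prob_space lambda01 lambda01 ..

lemma AE_lambda01: "AE x in lborel. P x \<Longrightarrow> AE x in lambda01. P x"
  unfolding lambda01_def by (subst AE_restrict_space_iff) (auto elim: AE_mp)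

lemma measurable_lambda01 [measurable]: "(\<lambda>x. x) \<in> borel_measurable lambda01"
  unfolding lambda01_def by (simp add: measurable_restrict_space1)

text \<open>\<open>P\<close> need not define a measurable set, whereas Fubini requires one; a
  measurable null set containing the exceptions takes its place.\<close>

lemma AE_pair_lambda01:
  assumes "AE p in lborel \<Otimes>\<^sub>M lborel. P p"
  shows "AE p in lambda01 \<Otimes>\<^sub>M lambda01. P p"
proof -
  obtain N where N: "N \<in> null_sets (lborel \<Otimes>\<^sub>M lborel)" "{p. \<not> P p} \<subseteq> N"
    using assms unfolding eventually_ae_filter by (auto simp: space_pair_measure)
  then have NS [measurable]: "N \<in> sets (borel \<Otimes>\<^sub>M borel)"
    by (metis null_setsD2 sets_lborel sets_pair_measure_cong)
  have "AE p in lborel \<Otimes>\<^sub>M lborel. p \<notin> N" using N(1) by (rule AE_not_in)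
  then have "AE x in lborel. AE y in lborel. (x, y) \<notin> N" by (rule lborel_pair.AE_pair)
  then have "AE x in lambda01. AE y in lborel. (x, y) \<notin> N" by (rule AE_lambda01)
  then have "AE x in lambda01. AE y in lambda01. (x, y) \<notin> N" by (rule AE_mp) (auto intro: AE_I2 AE_lambda01)
  then have "AE p in lambda01 \<Otimes>\<^sub>M lambda01. p \<notin> N"
  proof (rule lambda01_pair.AE_pair_measure[rotated])
    have "(\<lambda>p. (fst p, snd p)) \<in> lambda01 \<Otimes>\<^sub>M lambda01 \<rightarrow>\<^sub>M borel \<Otimes>\<^sub>M borel" by measurable
    then have [measurable]: "(\<lambda>p. p) \<in> lambda01 \<Otimes>\<^sub>M lambda01 \<rightarrow>\<^sub>M borel \<Otimes>\<^sub>M borel" by simp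
    show "{p \<in> space (lambda01 \<Otimes>\<^sub>M lambda01). p \<notin> N} \<in> sets (lambda01 \<Otimes>\<^sub>M lambda01)"
      by measurable
  qed
  then show ?thesis by (rule AE_mp) (use N(2) in \<open>auto intro!: AE_I2\<close>)
qed

lemma AE_fst_snd:
  fixes P :: "real \<Rightarrow> bool"
  assumes "AE x in lborel. P x"
  shows "AE p in lborel \<Otimes>\<^sub>M (lborel :: real measure). P (fst p)"
    "AE p in (lborel :: real measure) \<Otimes>\<^sub>M lborel. P (snd p)"
proof -
  obtain N where N: "N \<in> null_sets lborel" "{x::real. \<not> P x} \<subseteq> N"
    using assms unfolding eventually_ae_filter by auto
  have "N \<times> UNIV \<in> null_sets (lborel \<Otimes>\<^sub>M (lborel :: real measure))"
    using N by (intro lborel.times_in_null_sets1) auto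
  then show "AE p in lborel \<Otimes>\<^sub>M (lborel :: real measure). P (fst p)" by (rule AE_I') (use N in auto)
  have "UNIV \<times> N \<in> null_sets ((lborel :: real measure) \<Otimes>\<^sub>M lborel)"
    using N by (intro lborel.times_in_null_sets2) auto
  then show "AE p in (lborel :: real measure) \<Otimes>\<^sub>M lborel. P (snd p)" by (rule AE_I') (use N in auto)
qed

lemma phi1_measurable:
  assumes [measurable]: "T \<in> borel_measurable borel"
  shows "(\<lambda>p. phi1 T (fst p) (snd p)) \<in> borel_measurable (lambda01 \<Otimes>\<^sub>M lambda01)"
proof -
  have [measurable]: "(T ^^ n) \<in> borel_measurable borel" for n by (induction n) auto
  show ?thesis unfolding phi1_def by measurable
qed

lemma eventually_mem_eq_UN_INT:
  fixes V :: "nat \<Rightarrow> 'a set"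
  assumes "\<And>k. V k \<subseteq> S"
  shows "{x \<in> S. \<forall>\<^sub>F k in sequentially. x \<in> V k} = (\<Union>K. \<Inter>k\<in>{K..}. V k)"
proof (intro set_eqI iffI)
  fix x assume "x \<in> (\<Union>K. \<Inter>k\<in>{K..}. V k)"
  then obtain K where K: "\<And>k. K \<le> k \<Longrightarrow> x \<in> V k" by auto
  then show "x \<in> {x \<in> S. \<forall>\<^sub>F k in sequentially. x \<in> V k}"
    using assms[of K] K[of K] by (auto simp: eventually_sequentially)
qed (auto simp: eventually_sequentially)

locale two_towers =
  X: tower_sequence T HX loX WX dX sX eX levX X +
  Y: tower_sequence T HY loY WY dY sY eY levY Y
  for T and HX loX WX dX sX eX levX X HY loY WY dY sY eY levY Y +
  assumes XY_disjoint: "X k \<inter> Y k = {}"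
    and rest: "emeasure lborel ({0..<1} - (X k \<union> Y k)) \<le> ennreal (3 / 2 ^ k)"
begin

text \<open>\<open>AE_nest\<close> leads only from stage k + 1 back to stage k. It still gives
  persistence forwards: a point of \<open>X k\<close> found in \<open>Y (Suc k)\<close> would belong
  to \<open>Y k\<close> too, and late stages leave no third place to be.\<close>

lemma AE_settles:
  "AE x in lborel. x \<in> {0..<1} \<longrightarrow>
    (\<forall>\<^sub>F k in sequentially. x \<in> X k) \<or> (\<forall>\<^sub>F k in sequentially. x \<in> Y k)"
proof -
  have "AE x in lborel. \<forall>\<^sub>F k in sequentially. x \<notin> {0..<1} - (X k \<union> Y k)"
    by (rule AE_eventually_notin[where C=3]) (auto simp: rest X.X_meas Y.X_meas)
  then show ?thesis using X.AE_nest Y.AE_nest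
  proof eventually_elim
    case (elim x)
    show ?case
    proof
      assume x: "x \<in> {0..<1}"
      from elim have "\<forall>\<^sub>F k in sequentially. x \<in> X k \<union> Y k \<and> (x \<in> X (Suc k) \<longrightarrow> x \<in> X k) \<and> (x \<in> Y (Suc k) \<longrightarrow> x \<in> Y k)"
        by eventually_elim (use x in auto)
      then obtain K where K: "\<And>k. K \<le> k \<Longrightarrow> x \<in> X k \<union> Y k"
        "\<And>k. K \<le> k \<Longrightarrow> x \<in> X (Suc k) \<Longrightarrow> x \<in> X k" "\<And>k. K \<le> k \<Longrightarrow> x \<in> Y (Suc k) \<Longrightarrow> x \<in> Y k"
        by (auto simp: eventually_sequentially)
      show "(\<forall>\<^sub>F k in sequentially. x \<in> X k) \<or> (\<forall>\<^sub>F k in sequentially. x \<in> Y k)"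
      proof (cases "x \<in> X K")
        case True
        have "x \<in> X k" if "K \<le> k" for k
          using that
        proof (induction k rule: dec_induct)
          case (step k)
          then show ?case using K(1)[of "Suc k"] K(3)[of k] XY_disjoint[of k] by auto
        qed (rule True)
        then show ?thesis by (auto simp: eventually_sequentially)
      next
        case False
        have "x \<in> Y k" if "K \<le> k" for k
          using that
        proof (induction k rule: dec_induct)
          case base
          show ?case using K(1)[of K] False by auto
        next
          case (step k)
          then show ?case using K(1)[of "Suc k"] K(2)[of k] XY_disjoint[of k] by auto
        qed
        then show ?thesis by (auto simp: eventually_sequentially)
      qed
    qed
  qed
qed

definition A :: "real set" where "A = {x \<in> {0..<1}. \<forall>\<^sub>F k in sequentially. x \<in> X k}"
definition B :: "real set" where "B = {x \<in> {0..<1}. \<forall>\<^sub>F k in sequentially. x \<in> Y k}"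

lemma AB_meas [measurable]: "A \<in> sets lambda01" "B \<in> sets lambda01"
proof -
  have "A = (\<Union>K. \<Inter>k\<in>{K..}. X k)" "B = (\<Union>K. \<Inter>k\<in>{K..}. Y k)"
    unfolding A_def B_def by (intro eventually_mem_eq_UN_INT X.X_subset Y.X_subset)+
  moreover have "(\<Union>K. \<Inter>k\<in>{K..}. X k) \<in> sets borel" "(\<Union>K. \<Inter>k\<in>{K..}. Y k) \<in> sets borel"
    using X.X_meas(1) Y.X_meas(1)
    by (intro sets.countable_UN sets.countable_INT' image_subsetI; simp)+
  ultimately have "A \<in> sets borel" "B \<in> sets borel" by simp_all
  moreover have "A \<subseteq> {0..<1}" "B \<subseteq> {0..<1}" by (auto simp: A_def B_def)
  ultimately show "A \<in> sets lambda01" "B \<in> sets lambda01"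
    by (simp_all add: lambda01_def sets_restrict_space_iff)
qed

lemma AB_disjoint: "A \<inter> B = {}"
proof -
  have False if "\<forall>\<^sub>F k in sequentially. x \<in> X k" "\<forall>\<^sub>F k in sequentially. x \<in> Y k" for x
  proof -
    have "\<forall>\<^sub>F k in sequentially. False" using that by eventually_elim (use XY_disjoint in auto)
    then show False by simp
  qed
  then show ?thesis by (auto simp: A_def B_def)
qed

text \<open>Upper bounds pass to these limit sets, because the intersection of all
  \<open>V k\<close> with \<open>k \<ge> K\<close> lies in \<open>V K\<close>; lower bounds do not
  pass directly. The mass of one tower is therefore used to bound the limit set of the other, and
  \<open>measure_AB\<close> then gives lower bounds.\<close>

lemma measure_AB_le:
  assumes "\<And>k. ennreal c \<le> emeasure lborel (X k)" "\<And>k. ennreal c \<le> emeasure lborel (Y k)" "0 \<le> c"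
  shows "measure lambda01 A \<le> 1 - c" "measure lambda01 B \<le> 1 - c"
proof -
  have *: "measure lambda01 {x \<in> {0..<1}. \<forall>\<^sub>F k in sequentially. x \<in> V k} \<le> 1 - c"
    if V: "\<And>k. V k \<in> sets borel" "\<And>k. V k \<subseteq> {0..<1}" and U: "\<And>k. U k \<in> sets borel" "\<And>k. U k \<subseteq> {0..<1}"
      and VU: "\<And>k. V k \<inter> U k = {}" and c: "\<And>k. ennreal c \<le> emeasure lborel (U k)" for V U :: "nat \<Rightarrow> real set"
  proof -
    have lam: "S \<in> sets borel \<Longrightarrow> S \<subseteq> {0..<1} \<Longrightarrow> S \<in> sets lambda01 \<and> emeasure lambda01 S = emeasure lborel S" for S :: "real set"
      by (force simp: lambda01_def sets_restrict_space_iff emeasure_restrict_space)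
    have Vle: "measure lambda01 (V k) \<le> 1 - c" for k
    proof -
      have "ennreal c \<le> emeasure lambda01 (U k)" using c[of k] lam[OF U, of k] by simp
      then have "c \<le> measure lambda01 (U k)" by (simp add: lambda01.emeasure_eq_measure)
      moreover have "measure lambda01 (V k) + measure lambda01 (U k) = measure lambda01 (V k \<union> U k)"
        using VU lam U V by (intro lambda01.finite_measure_Union[symmetric]) auto
      ultimately show ?thesis using lambda01.prob_le_1[of "V k \<union> U k"] by linarith
    qed
    define G where "G K = (\<Inter>k\<in>{K..}. V k)" for K
    have G_meas: "G K \<in> sets lambda01" for K
      unfolding G_def using lam V by (intro sets.countable_INT') auto
    have "incseq G" by (auto simp: G_def incseq_def)
    then have "(\<lambda>K. measure lambda01 (G K)) \<longlonglongrightarrow> measure lambda01 (\<Union>K. G K)"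
      using G_meas by (intro lambda01.finite_Lim_measure_incseq) auto
    moreover have "measure lambda01 (G K) \<le> 1 - c" for K
    proof -
      have "measure lambda01 (G K) \<le> measure lambda01 (V K)"
        using lam V by (intro lambda01.finite_measure_mono) (auto simp: G_def)
      with Vle[of K] show ?thesis by simp
    qed
    ultimately have "measure lambda01 (\<Union>K. G K) \<le> 1 - c" by (intro LIMSEQ_le_const2) auto
    moreover have "{x \<in> {0..<1}. \<forall>\<^sub>F k in sequentially. x \<in> V k} = (\<Union>K. G K)"
      unfolding G_def by (intro eventually_mem_eq_UN_INT V(2))
    ultimately show ?thesis by simp
  qed
  show "measure lambda01 A \<le> 1 - c" unfolding A_def
    by (rule *[of X Y]) (use X.X_meas Y.X_meas X.X_subset Y.X_subset XY_disjoint assms in auto)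
  show "measure lambda01 B \<le> 1 - c" unfolding B_def
    by (rule *[of Y X]) (use X.X_meas Y.X_meas X.X_subset Y.X_subset XY_disjoint assms in \<open>auto simp: Int_commute\<close>)
qed

lemma AE_AB: "AE x in lambda01. x \<in> A \<union> B"
proof -
  have "AE x in lambda01. x \<in> {0..<1}" using AE_space[of lambda01] by simp
  with AE_lambda01[OF AE_settles] show ?thesis by eventually_elim (auto simp: A_def B_def)
qed

lemma measure_AB: "measure lambda01 A + measure lambda01 B = 1"
proof -
  have "measure lambda01 (A \<union> B) = 1" using AE_AB by (subst lambda01.prob_eq_1) auto
  then show ?thesis using AB_disjoint by (simp add: lambda01.finite_measure_Union)
qed

lemma AE_phi1:
  "AE p in lambda01 \<Otimes>\<^sub>M lambda01. p \<in> A \<times> A \<union> B \<times> B \<and> phi1 T (fst p) (snd p) = 0 \<or>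
     p \<notin> A \<times> A \<union> B \<times> B \<and> phi1 T (fst p) (snd p) = \<infinity>"
proof -
  have nXY: "\<forall>\<^sub>F k in sequentially. x \<notin> Y k" if "\<forall>\<^sub>F k in sequentially. x \<in> X k" for x
    using that by eventually_elim (use XY_disjoint in auto)
  have nYX: "\<forall>\<^sub>F k in sequentially. x \<notin> X k" if "\<forall>\<^sub>F k in sequentially. x \<in> Y k" for x
    using that by eventually_elim (use XY_disjoint in auto)
  note AEs = AE_fst_snd[OF AE_settles] AE_fst_snd(1)[OF X.AE_generic(1)] AE_fst_snd(2)[OF X.AE_generic(2)]
    AE_fst_snd(1)[OF Y.AE_generic(1)] AE_fst_snd(2)[OF Y.AE_generic(2)] X.AE_phi1_zero Y.AE_phi1_zero
  from AEs[THEN AE_pair_lambda01] AE_space[of "lambda01 \<Otimes>\<^sub>M lambda01"] show ?thesis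
  proof eventually_elim
    case (elim p)
    obtain x y where p: "p = (x, y)" by (cases p)
    note E = elim[unfolded p fst_conv snd_conv]
    have xy: "x \<in> {0..<1}" "y \<in> {0..<1}" using E(9) by (auto simp: space_pair_measure)
    then have dich: "(\<forall>\<^sub>F k in sequentially. x \<in> X k) \<or> (\<forall>\<^sub>F k in sequentially. x \<in> Y k)"
      "(\<forall>\<^sub>F k in sequentially. y \<in> X k) \<or> (\<forall>\<^sub>F k in sequentially. y \<in> Y k)"
      using E(1,2) by blast+
    have AB: "x \<in> A \<longleftrightarrow> (\<forall>\<^sub>F k in sequentially. x \<in> X k)" "x \<in> B \<longleftrightarrow> (\<forall>\<^sub>F k in sequentially. x \<in> Y k)"
      "y \<in> A \<longleftrightarrow> (\<forall>\<^sub>F k in sequentially. y \<in> X k)" "y \<in> B \<longleftrightarrow> (\<forall>\<^sub>F k in sequentially. y \<in> Y k)"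
      using xy by (auto simp: A_def B_def)
    from dich AB consider "x \<in> A" "y \<in> A" | "x \<in> B" "y \<in> B" | "x \<in> A" "y \<in> B" | "x \<in> B" "y \<in> A" by blast
    then show ?case
    proof cases
      case 1
      then have "\<forall>\<^sub>F k in sequentially. x \<in> X k \<and> y \<in> X k" using AB by (simp add: eventually_conj_iff)
      with E(7) 1 show ?thesis unfolding p by simp
    next
      case 2
      then have "\<forall>\<^sub>F k in sequentially. x \<in> Y k \<and> y \<in> Y k" using AB by (simp add: eventually_conj_iff)
      with E(8) 2 show ?thesis unfolding p by simp
    next
      case 3
      then have "phi1 T x y = \<infinity>" using X.phi1_infinite[OF E(3,4)] AB nYX by blast
      with 3 show ?thesis unfolding p using AB_disjoint by auto
    next
      case 4
      then have "phi1 T x y = \<infinity>" using Y.phi1_infinite[OF E(5,6)] AB nXY by blast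
      with 4 show ?thesis unfolding p using AB_disjoint by auto
    qed
  qed
qed

theorem dichotomy:
  assumes T: "T \<in> borel_measurable borel"
    and c: "\<And>k. ennreal (1/4) \<le> emeasure lborel (X k)" "\<And>k. ennreal (1/4) \<le> emeasure lborel (Y k)"
  obtains b where "1/4 \<le> b" "b \<le> 3/4"
    "AE p in lambda01 \<Otimes>\<^sub>M lambda01. phi1 T (fst p) (snd p) \<in> {0, \<infinity>}"
    "{p \<in> space (lambda01 \<Otimes>\<^sub>M lambda01). phi1 T (fst p) (snd p) = 0} \<in> sets (lambda01 \<Otimes>\<^sub>M lambda01)"
    "emeasure (lambda01 \<Otimes>\<^sub>M lambda01) {p \<in> space (lambda01 \<Otimes>\<^sub>M lambda01). phi1 T (fst p) (snd p) = 0} = ennreal b"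
proof -
  let ?M = "lambda01 \<Otimes>\<^sub>M lambda01" and ?Z = "{p \<in> space (lambda01 \<Otimes>\<^sub>M lambda01). phi1 T (fst p) (snd p) = 0}"
  define a where "a = measure lambda01 A"
  have b: "measure lambda01 B = 1 - a" using measure_AB by (simp add: a_def)
  have a: "1/4 \<le> a" "a \<le> 3/4" using measure_AB_le[OF c] b by (auto simp: a_def)
  have Z: "?Z \<in> sets ?M" using phi1_measurable[OF T] by measurable
  have "emeasure ?M ?Z = emeasure ?M (A \<times> A \<union> B \<times> B)"
  proof (rule emeasure_eq_AE)
    show "AE p in ?M. p \<in> ?Z \<longleftrightarrow> p \<in> A \<times> A \<union> B \<times> B"
      using AE_phi1 AE_space by eventually_elim auto
  qed (use Z in auto)
  also have "\<dots> = emeasure ?M (A \<times> A) + emeasure ?M (B \<times> B)"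
    using AB_disjoint by (intro plus_emeasure[symmetric]) auto
  also have "\<dots> = ennreal (a * a + (1 - a) * (1 - a))"
    using a by (simp add: lambda01.emeasure_pair_measure_Times lambda01.emeasure_eq_measure b a_def[symmetric]
        ennreal_mult[symmetric] ennreal_plus[symmetric] del: ennreal_plus)
  finally have eq: "emeasure ?M ?Z = ennreal (a * a + (1 - a) * (1 - a))" .
  have ab: "a * a + (1 - a) * (1 - a) = 1 - 2 * (a * (1 - a))" by (simp add: algebra_simps)
  \<comment> \<open>For a in [1/4, 3/4] the product even lies between 3/16 and 1/4; the cruder
    bounds 1/8 and 3/8 correspond exactly to the required range of b.\<close>
  have "a * (1 - a) \<le> 3/8"
  proof (cases "a \<le> 1/2")
    case True
    then have "a * (1 - a) \<le> 1/2 * (3/4)" using a by (intro mult_mono) auto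
    then show ?thesis by simp
  next
    case False
    then have "a * (1 - a) \<le> 3/4 * (1/2)" using a by (intro mult_mono) auto
    then show ?thesis by simp
  qed
  then have lower: "1/4 \<le> a * a + (1 - a) * (1 - a)" unfolding ab by simp
  have "1/4 * (1/2) \<le> a * (1 - a)"
  proof (cases "a \<le> 1/2")
    case True
    then show ?thesis using a by (intro mult_mono) auto
  next
    case False
    then have "(1/2) * (1/4) \<le> a * (1 - a)" using a by (intro mult_mono) auto
    then show ?thesis by simp
  qed
  then have upper: "a * a + (1 - a) * (1 - a) \<le> 3/4" unfolding ab by simp
  have "AE p in ?M. phi1 T (fst p) (snd p) \<in> {0, \<infinity>}" using AE_phi1 by eventually_elim auto
  from that[OF lower upper this Z eq] show thesis .
qed

end

section \<open>Keane's interval exchange transformations\<close>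

text \<open>If two interiors met, the overlap could be cut out of one interval, leaving a cover of
  [0,1) of total length below 1. This yields disjoint levels without any discussion of injectivity
  of the map.\<close>

lemma cover_disjoint:
  fixes a l :: "'i \<Rightarrow> real"
  assumes "finite I" and cov: "{0..<1} \<subseteq> (\<Union>i\<in>I. {a i..a i + l i})"
    and l: "\<And>i. i \<in> I \<Longrightarrow> 0 < l i" "(\<Sum>i\<in>I. l i) \<le> 1" and ij: "i \<in> I" "j \<in> I" "i \<noteq> j"
  shows "{a i<..<a i + l i} \<inter> {a j<..<a j + l j} = {}"
proof (rule ccontr)
  assume ne: "{a i<..<a i + l i} \<inter> {a j<..<a j + l j} \<noteq> {}"
  define c c' where "c = max (a i) (a j)" and "c' = min (a i + l i) (a j + l j)"
  have cc: "c < c'" "a i \<le> c" "a j \<le> c" "c' \<le> a i + l i" "c' \<le> a j + l j"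
    using ne by (auto simp: c_def c'_def)
  \<comment> \<open>Interval \<open>i\<close> is replaced by what remains of it to the left
    (\<open>True\<close>) and to the right (\<open>False\<close>) of the overlap.\<close>
  define J where "J = (I - {i}) <+> (UNIV :: bool set)"
  define p where "p = case_sum a (\<lambda>b. if b then a i else c')"
  define q where "q = case_sum (\<lambda>s. a s + l s) (\<lambda>b. if b then c else a i + l i)"
  have "emeasure lborel {0..<1::real} \<le> ennreal (1 - (c' - c))"
  proof (rule emeasure_cover_le[where I=J and a=p and b=q])
    show "{0..<1} \<subseteq> (\<Union>s\<in>J. {p s..q s})"
    proof
      fix x :: real assume "x \<in> {0..<1}"
      then obtain s where s: "s \<in> I" "x \<in> {a s..a s + l s}" using cov by blast
      consider "s \<noteq> i" | "s = i" "x \<le> c" | "s = i" "c' \<le> x" | "c < x" "x < c'" by linarith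
      then show "x \<in> (\<Union>s\<in>J. {p s..q s})"
      proof cases
        case 1
        then show ?thesis using s by (intro UN_I[of "Inl s"]) (auto simp: J_def p_def q_def)
      next
        case 2
        then show ?thesis using s by (intro UN_I[of "Inr True"]) (auto simp: J_def p_def q_def)
      next
        case 3
        then show ?thesis using s by (intro UN_I[of "Inr False"]) (auto simp: J_def p_def q_def)
      next
        case 4
        then show ?thesis using ij cc by (intro UN_I[of "Inl j"]) (auto simp: J_def p_def q_def)
      qed
    qed
    show "p s \<le> q s" if "s \<in> J" for s
      using that l(1) cc by (auto simp: J_def p_def q_def less_imp_le)
    have "(\<Sum>s\<in>J. q s - p s) = (\<Sum>s\<in>I - {i}. l s) + ((c - a i) + (a i + l i - c'))"
      unfolding J_def using assms(1) by (subst sum.Plus) (auto simp: p_def q_def UNIV_bool)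
    also have "\<dots> = (\<Sum>s\<in>I. l s) - (c' - c)" using assms(1) ij(1) by (simp add: sum_diff1)
    finally show "(\<Sum>s\<in>J. q s - p s) \<le> 1 - (c' - c)" using l(2) by simp
  qed (use assms(1) in \<open>simp add: J_def\<close>)
  moreover have "emeasure lborel {0..<1::real} = ennreal 1" by simp
  ultimately have "ennreal 1 \<le> ennreal (1 - (c' - c))" by metis
  then show False using cc(1) by (simp add: ennreal_le_iff2)
qed

text \<open>
  The map induced by Keane's transformation on its fourth interval has the same permutation, but
  only when it is read from right to left. Half-open intervals therefore change the side on which
  they are closed from one stage to the next. The open variant serves for the interiors of levels.
\<close>
datatype ends = Left_closed | Right_closed | Open

primrec mirror :: "ends \<Rightarrow> ends" where
  "mirror Left_closed = Right_closed" | "mirror Right_closed = Left_closed" | "mirror Open = Open"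

primrec seg :: "ends \<Rightarrow> real \<Rightarrow> real \<Rightarrow> real set" where
  "seg Left_closed a b = {a..<b}" | "seg Right_closed a b = {a<..b}" | "seg Open a b = {a<..<b}"

lemma mirror_mirror [simp]: "mirror (mirror c) = c"
  by (cases c) auto

lemma seg_le: "t \<in> seg c a b \<Longrightarrow> a \<le> t \<and> t \<le> b"
  by (cases c) auto

text \<open>\<open>s\<close> is the image of \<open>t\<close> under the reflection with constant
  \<open>s + t\<close>, which swaps the two ends and thereby the closed side.\<close>

lemma seg_reflect:
  assumes "t \<in> seg (mirror c) x y" "a \<le> s + t - y" "s + t - x \<le> b"
  shows "s \<in> seg c a b"
  using assms by (cases c) auto

lemma seg_shift: "t \<in> seg c a b \<Longrightarrow> a' \<le> a + u \<Longrightarrow> b + u \<le> b' \<Longrightarrow> t + u \<in> seg c a' b'"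
  by (cases c) auto

lemma seg_between:
  assumes "t \<in> seg c a b" "t + z \<in> seg c a b" "0 \<le> r" "r \<le> 1"
  shows "t + r * z \<in> seg c a b"
proof (cases "0 \<le> z")
  case True
  then have "0 \<le> r * z" "r * z \<le> z" using assms by (auto simp: mult_left_le_one_le)
  with assms(1,2) show ?thesis by (cases c) auto
next
  case False
  then have "r * z \<le> 0" using assms by (simp add: mult_nonneg_nonpos)
  moreover have "z \<le> r * z" using False assms(4) mult_right_mono_neg[of r 1 z] by simp
  ultimately show ?thesis using assms(1,2) by (cases c) auto
qed

lemma seg_split: "t \<in> seg c a b \<Longrightarrow> a \<le> z \<Longrightarrow> z \<le> b \<Longrightarrow> c \<noteq> Open \<Longrightarrow> t \<in> seg c a z \<or> t \<in> seg c z b"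
  by (cases c) auto

lemma seg_mod:
  assumes "t \<in> seg c 0 (real N * z)" "0 < z" "c \<noteq> Open"
  shows "\<exists>q<N. t - real q * z \<in> seg c 0 z"
  using assms(1)
proof (induction N)
  case 0
  then show ?case using assms(3) by (cases c) auto
next
  case (Suc N)
  have "t \<in> seg c 0 (real N * z) \<or> t \<in> seg c (real N * z) (real (Suc N) * z)"
    by (rule seg_split) (use Suc.prems assms in auto)
  then show ?case
  proof
    assume "t \<in> seg c 0 (real N * z)"
    with Suc.IH show ?thesis using less_SucI by blast
  next
    assume "t \<in> seg c (real N * z) (real (Suc N) * z)"
    then have "t - real N * z \<in> seg c 0 z" by (cases c) (auto simp: algebra_simps)
    then show ?thesis by blast
  qed
qed

section \<open>Keane's permutation and the return words\<close>

definition keane_perm :: "nat \<Rightarrow> nat" where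
  "keane_perm i = (if i = 1 then 3 else if i = 3 then 4 else if i = 4 then 1 else i)"

text \<open>
  \<open>w k\<close> contains the lengths of the four intervals at stage \<open>k\<close>. The recurrence inverts the passage to
  the induced map: \<open>m k\<close> and \<open>n k\<close> count the consecutive visits to the second and the third
  interval before the return to the fourth one.
\<close>
locale keane_lengths =
  fixes m n :: "nat \<Rightarrow> nat" and w :: "nat \<Rightarrow> nat \<Rightarrow> real"
  assumes m2: "2 \<le> m k" and n2: "2 \<le> n k"
    and w_pos: "i \<in> {1,2,3,4} \<Longrightarrow> 0 < w k i"
    and w_rec: "w k 1 = w (Suc k) 3 + w (Suc k) 4"
      "w k 2 = (real (m k) - 1) * w (Suc k) 1 + real (m k) * w (Suc k) 2"
      "w k 3 = real (n k) * (w (Suc k) 1 + w (Suc k) 2 + w (Suc k) 4) + (real (n k) - 1) * w (Suc k) 3"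
      "w k 4 = w (Suc k) 1 + w (Suc k) 2 + w (Suc k) 3 + w (Suc k) 4"
    and w_total: "w 0 1 + w 0 2 + w 0 3 + w 0 4 = 1"
begin

definition ofs :: "nat \<Rightarrow> nat \<Rightarrow> real" where
  "ofs k i = (if i = 1 then 0 else if i = 2 then w k 1 else if i = 3 then w k 1 + w k 2
    else w k 1 + w k 2 + w k 3)"

text \<open>The images of the pieces stand from left to right in the order 4, 2, 1, 3.\<close>

definition sh :: "nat \<Rightarrow> nat \<Rightarrow> real" where
  "sh k i = (if i = 1 then w k 4 + w k 2 else if i = 2 then w k 4 - w k 1 else if i = 3 then w k 4
    else - (w k 1 + w k 2 + w k 3))"

definition len :: "nat \<Rightarrow> real" where
  "len k = w k 1 + w k 2 + w k 3 + w k 4"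

definition piece :: "ends \<Rightarrow> nat \<Rightarrow> nat \<Rightarrow> real set" where
  "piece c k i = seg c (ofs k i) (ofs k i + w k i)"

primrec follows :: "ends \<Rightarrow> nat \<Rightarrow> real \<Rightarrow> nat list \<Rightarrow> bool" where
  "follows c k t [] \<longleftrightarrow> True"
| "follows c k t (i # ws) \<longleftrightarrow> i \<in> {1,2,3,4} \<and> t \<in> piece c k i \<and> follows c k (t + sh k i) ws"

definition total :: "nat \<Rightarrow> nat list \<Rightarrow> real" where
  "total k ws = sum_list (map (sh k) ws)"

text \<open>
  The itinerary of the points of piece \<open>i\<close> of stage \<open>k + 1\<close> through the pieces of stage \<open>k\<close>; a point
  with coordinate \<open>t\<close> at stage \<open>k + 1\<close> has coordinate \<open>len k - t\<close> at stage \<open>k\<close>.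
\<close>
definition word :: "nat \<Rightarrow> nat \<Rightarrow> nat list" where
  "word k i = 4 # (if i = 1 then replicate (m k - 1) 2 @ replicate (n k) 3
     else if i = 2 then replicate (m k) 2 @ replicate (n k) 3
     else if i = 3 then 1 # replicate (n k - 1) 3
     else 1 # replicate (n k) 3)"

lemma total_simps [simp]:
  "total k [] = 0" "total k (i # ws) = sh k i + total k ws"
  "total k (us @ vs) = total k us + total k vs" "total k (replicate p i) = real p * sh k i"
  by (auto simp: total_def sum_list_replicate)

lemma follows_append [simp]:
  "follows c k t (us @ vs) \<longleftrightarrow> follows c k t us \<and> follows c k (t + total k us) vs"
  by (induction us arbitrary: t) (auto simp: add.assoc)

text \<open>Pieces are convex, so only the first and the last visit of a run have to be
  checked.\<close>

lemma follows_replicate: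
  assumes "i \<in> {1,2,3,4}" "t \<in> piece c k i" "t + (real p - 1) * sh k i \<in> piece c k i"
  shows "follows c k t (replicate p i)"
  using assms(2,3)
proof (induction p arbitrary: t)
  case (Suc p)
  have "follows c k (t + sh k i) (replicate p i)"
  proof (cases "p = 0")
    case False
    have e: "t + real p * sh k i = (t + sh k i) + (real p - 1) * sh k i" by (simp add: algebra_simps)
    have "t + 1 / real p * (real p * sh k i) \<in> piece c k i"
      unfolding piece_def by (rule seg_between) (use Suc.prems False in \<open>auto simp: piece_def\<close>)
    then have "t + sh k i \<in> piece c k i" using False by simp
    with Suc.IH[OF this] Suc.prems e show ?thesis by simp
  qed simp
  with assms(1) Suc.prems show ?case by simp
qed simp

lemma vals:
  "ofs k 1 = 0" "ofs k 2 = w k 1" "ofs k 3 = w k 1 + w k 2" "ofs k 4 = w k 1 + w k 2 + w k 3"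
  "sh k 1 = w k 4 + w k 2" "sh k 2 = w k 4 - w k 1" "sh k 3 = w k 4" "sh k 4 = - (w k 1 + w k 2 + w k 3)"
  by (simp_all add: ofs_def sh_def)

text \<open>Products such as \<open>m k * w k i\<close> are atoms for linear arithmetic; the last
  six bounds supply what it has to know about them.\<close>

lemma pos:
  "0 < w k 1" "0 < w k 2" "0 < w k 3" "0 < w k 4"
  "2 * w k 1 \<le> real (m j) * w k 1" "2 * w k 2 \<le> real (m j) * w k 2"
  "2 * w k 1 \<le> real (n j) * w k 1" "2 * w k 2 \<le> real (n j) * w k 2"
  "2 * w k 3 \<le> real (n j) * w k 3" "2 * w k 4 \<le> real (n j) * w k 4"
  using m2[of j] n2[of j] w_pos[of 1 k] w_pos[of 2 k] w_pos[of 3 k] w_pos[of 4 k]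
  by (auto intro!: mult_right_mono simp del: One_nat_def)

lemma real_pred: "real (m k - 1) = real (m k) - 1" "real (n k - 1) = real (n k) - 1"
  using m2[of k] n2[of k] by auto

text \<open>The return map to piece 4, read in the reflected coordinate, is the exchange of stage k
  + 1. Once \<open>w_rec\<close> expresses everything by the lengths of stage k + 1, each visit is a
  linear inequality.\<close>

lemma word_follows:
  assumes i: "i \<in> {1,2,3,4}" and t: "t \<in> piece (mirror c) (Suc k) i"
  shows "follows c k (len k - t) (word k i)"
    and "len k - t + total k (word k i) = len k - (t + sh (Suc k) i)"
proof -
  note t' = t[unfolded piece_def]
  note p = pos(1-4)[of "Suc k"] pos(5-10)[of "Suc k" k]
  note defs = vals len_def w_rec[of k] real_pred ring_distribs
  consider "i = 1" | "i = 2" | "i = 3" | "i = 4" using i by auto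
  then have "follows c k (len k - t) (word k i) \<and>
    len k - t + total k (word k i) = len k - (t + sh (Suc k) i)"
  proof cases
    case 1
    note r = seg_reflect[OF t'[unfolded 1]]
    have "len k - t \<in> piece c k 4" "len k - t + sh k 4 \<in> piece c k 2"
      "len k - t + sh k 4 + (real (m k - 1) - 1) * sh k 2 \<in> piece c k 2"
      "len k - t + sh k 4 + real (m k - 1) * sh k 2 \<in> piece c k 3"
      "len k - t + sh k 4 + real (m k - 1) * sh k 2 + (real (n k) - 1) * sh k 3 \<in> piece c k 3"
      unfolding piece_def by (rule r; use p in \<open>simp only: defs; linarith\<close>)+
    moreover have "sh k 4 + (real (m k - 1) * sh k 2 + real (n k) * sh k 3) = - sh (Suc k) 1"
      using p by (simp only: defs; linarith)
    ultimately show ?thesis unfolding 1 word_def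
      using follows_replicate[of 2] follows_replicate[of 3] by (simp add: add.assoc)
  next
    case 2
    note r = seg_reflect[OF t'[unfolded 2]]
    have "len k - t \<in> piece c k 4" "len k - t + sh k 4 \<in> piece c k 2"
      "len k - t + sh k 4 + (real (m k) - 1) * sh k 2 \<in> piece c k 2"
      "len k - t + sh k 4 + real (m k) * sh k 2 \<in> piece c k 3"
      "len k - t + sh k 4 + real (m k) * sh k 2 + (real (n k) - 1) * sh k 3 \<in> piece c k 3"
      unfolding piece_def by (rule r; use p in \<open>simp only: defs; linarith\<close>)+
    moreover have "sh k 4 + (real (m k) * sh k 2 + real (n k) * sh k 3) = - sh (Suc k) 2"
      using p by (simp only: defs; linarith)
    ultimately show ?thesis unfolding 2 word_def
      using follows_replicate[of 2] follows_replicate[of 3] by (simp add: add.assoc)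
  next
    case 3
    note r = seg_reflect[OF t'[unfolded 3]]
    have "len k - t \<in> piece c k 4" "len k - t + sh k 4 \<in> piece c k 1"
      "len k - t + sh k 4 + sh k 1 \<in> piece c k 3"
      "len k - t + sh k 4 + sh k 1 + (real (n k - 1) - 1) * sh k 3 \<in> piece c k 3"
      unfolding piece_def by (rule r; use p in \<open>simp only: defs; linarith\<close>)+
    moreover have "sh k 4 + (sh k 1 + real (n k - 1) * sh k 3) = - sh (Suc k) 3"
      using p by (simp only: defs; linarith)
    ultimately show ?thesis unfolding 3 word_def
      using follows_replicate[of 3] by (simp add: add.assoc)
  next
    case 4
    note r = seg_reflect[OF t'[unfolded 4]]
    have "len k - t \<in> piece c k 4" "len k - t + sh k 4 \<in> piece c k 1"
      "len k - t + sh k 4 + sh k 1 \<in> piece c k 3"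
      "len k - t + sh k 4 + sh k 1 + (real (n k) - 1) * sh k 3 \<in> piece c k 3"
      unfolding piece_def by (rule r; use p in \<open>simp only: defs; linarith\<close>)+
    moreover have "sh k 4 + (sh k 1 + real (n k) * sh k 3) = - sh (Suc k) 4"
      using p by (simp only: defs; linarith)
    ultimately show ?thesis unfolding 4 word_def
      using follows_replicate[of 3] by (simp add: add.assoc)
  qed
  then show "follows c k (len k - t) (word k i)"
    "len k - t + total k (word k i) = len k - (t + sh (Suc k) i)" by auto
qed

lemma replicate_split: "q < N \<Longrightarrow> replicate N x = replicate q x @ x # replicate (N - 1 - q) x"
  by (metis Suc_diff_1 Suc_diff_eq_diff_pred add_diff_inverse_nat diff_Suc_1 less_imp_le_nat not_less
      replicate_Suc replicate_add zero_less_diff diff_commute diff_diff_left)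

text \<open>The converse of \<open>word_follows\<close>: the words miss no point of stage k. The
  coordinate in the conclusion solves \<open>s = len k - t + total k us\<close> for
  \<open>t\<close>. The cases describe how the visits tile each piece.\<close>

lemma word_cover:
  assumes c: "c \<noteq> Open" and i: "i \<in> {1,2,3,4}" and s: "s \<in> piece c k i"
  obtains i' us vs where "i' \<in> {1,2,3,4}" "word k i' = us @ i # vs"
    "len k + total k us - s \<in> piece (mirror c) (Suc k) i'"
proof -
  define a b d e where "a = w (Suc k) 1" and "b = w (Suc k) 2" and "d = w (Suc k) 3" and "e = w (Suc k) 4"
  note abde = a_def b_def d_def e_def
  note p = pos(1-4)[of "Suc k"] pos(5-10)[of "Suc k" k]
  note defs = vals len_def w_rec[of k] real_pred ring_distribs
  have refl: "z - s \<in> seg (mirror c) x y" if "s \<in> seg c x' y'" "x \<le> z - y'" "z - x' \<le> y" for z x y x' y'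
    using that by (intro seg_reflect[of s "mirror c" x' y']) auto
  consider "i = 1" | "i = 2" | "i = 3" | "i = 4" using i by auto
  then show thesis
  proof cases
    case 4
    have s': "s \<in> seg c (len k - a - b - d - e) (len k)"
      using s unfolding piece_def 4 abde by (simp only: defs; cases c; simp)
    have "s \<in> seg c (len k - a - b - d - e) (len k - a - b - d) \<or> s \<in> seg c (len k - a - b - d) (len k - a - b)
      \<or> s \<in> seg c (len k - a - b) (len k - a) \<or> s \<in> seg c (len k - a) (len k)"
      using s' c p unfolding abde by (cases c) auto
    then consider (1) "s \<in> seg c (len k - a) (len k)" | (2) "s \<in> seg c (len k - a - b) (len k - a)"
      | (3) "s \<in> seg c (len k - a - b - d) (len k - a - b)" | (4) "s \<in> seg c (len k - a - b - d - e) (len k - a - b - d)"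
      by blast
    then show ?thesis
    proof cases
      case 1
      have "len k + total k [] - s \<in> piece (mirror c) (Suc k) 1"
        unfolding piece_def by (rule refl[OF 1]; simp only: vals abde total_simps; linarith)
      then show ?thesis by (intro that[of 1 "[]" "tl (word k 1)"]) (auto simp: word_def \<open>i = 4\<close>)
    next
      case 2
      have "len k + total k [] - s \<in> piece (mirror c) (Suc k) 2"
        unfolding piece_def by (rule refl[OF 2]; simp only: vals abde total_simps; linarith)
      then show ?thesis by (intro that[of 2 "[]" "tl (word k 2)"]) (auto simp: word_def \<open>i = 4\<close>)
    next
      case 3
      have "len k + total k [] - s \<in> piece (mirror c) (Suc k) 3"
        unfolding piece_def by (rule refl[OF 3]; simp only: vals abde total_simps; linarith)
      then show ?thesis by (intro that[of 3 "[]" "tl (word k 3)"]) (auto simp: word_def \<open>i = 4\<close>)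
    next
      case 4
      have "len k + total k [] - s \<in> piece (mirror c) (Suc k) 4"
        unfolding piece_def by (rule refl[OF 4]; simp only: vals abde total_simps; linarith)
      then show ?thesis by (intro that[of 4 "[]" "tl (word k 4)"]) (auto simp: word_def \<open>i = 4\<close>)
    qed
  next
    case 1
    have s': "s \<in> seg c 0 (e + d)" using s unfolding piece_def 1 abde by (simp only: defs; simp add: add.commute)
    have "s \<in> seg c 0 e \<or> s \<in> seg c e (e + d)"
      by (rule seg_split[OF s']) (use c p in \<open>auto simp: abde\<close>)
    then show ?thesis
    proof
      assume *: "s \<in> seg c 0 e"
      have "len k + total k [4] - s \<in> piece (mirror c) (Suc k) 4"
        unfolding piece_def by (rule refl[OF *]; simp only: defs abde total_simps; linarith)
      then show ?thesis by (intro that[of 4 "[4]" "replicate (n k) 3"]) (auto simp: word_def 1)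
    next
      assume *: "s \<in> seg c e (e + d)"
      have "len k + total k [4] - s \<in> piece (mirror c) (Suc k) 3"
        unfolding piece_def by (rule refl[OF *]; simp only: defs abde total_simps; linarith)
      then show ?thesis by (intro that[of 3 "[4]" "replicate (n k - 1) 3"]) (auto simp: word_def 1)
    qed
  next
    case 2
    have s': "s \<in> seg c (w k 1) (w k 1 + w k 2)" using s unfolding piece_def 2 by (simp only: vals)
    define u where "u = s - w k 1"
    have u: "u \<in> seg c 0 (w k 2)" using s' unfolding u_def by (cases c) auto
    \<comment> \<open>Visits tile piece 2 with period \<open>a + b\<close>: a block \<open>b\<close>
      from word 2, then a block \<open>a\<close> from word 1. Word 1 makes one visit fewer, so the
      last period lacks its \<open>a\<close>.\<close>
    have w2: "w k 2 = real (m k) * (a + b) - a" unfolding abde by (simp only: defs; linarith)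
    have ab: "0 < a" "0 < b" using p unfolding abde by auto
    have "u \<in> seg c 0 (real (m k) * (a + b))" using u ab unfolding w2 by (cases c) auto
    from seg_mod[OF this _ c] ab obtain q where q: "q < m k" "u - real q * (a + b) \<in> seg c 0 (a + b)" by auto
    define u0 where "u0 = u - real q * (a + b)"
    have su: "s = w k 1 + u0 + real q * (a + b)" by (simp add: u0_def u_def)
    have "u0 \<in> seg c 0 b \<or> u0 \<in> seg c b (a + b)"
      by (rule seg_split) (use q ab c in \<open>auto simp: u0_def\<close>)
    then show ?thesis
    proof
      assume *: "u0 \<in> seg c 0 b"
      then have *: "s \<in> seg c (w k 1 + real q * (a + b)) (w k 1 + real q * (a + b) + b)"
        unfolding su by (cases c) auto
      have "len k + total k (4 # replicate q 2) - s \<in> piece (mirror c) (Suc k) 2"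
        unfolding piece_def by (rule refl[OF *]; simp only: defs abde total_simps; linarith)
      then show ?thesis using replicate_split[OF q(1), of 2]
        by (intro that[of 2 "4 # replicate q 2" "replicate (m k - 1 - q) 2 @ replicate (n k) 3"]) (auto simp: word_def 2)
    next
      assume *: "u0 \<in> seg c b (a + b)"
      have "q \<noteq> m k - 1"
      proof
        assume "q = m k - 1"
        then have "u = u0 + (real (m k) - 1) * (a + b)" by (simp only: u0_def real_pred)
        then have "u = u0 + w k 2 - b" unfolding w2 by (simp add: algebra_simps)
        with * u c show False by (cases c) auto
      qed
      then have q': "q < m k - 1" using q(1) by simp
      from * have *: "s \<in> seg c (w k 1 + real q * (a + b) + b) (w k 1 + real q * (a + b) + b + a)"
        unfolding su by (cases c) auto
      have "len k + total k (4 # replicate q 2) - s \<in> piece (mirror c) (Suc k) 1"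
        unfolding piece_def by (rule refl[OF *]; simp only: defs abde total_simps; linarith)
      then show ?thesis using replicate_split[OF q', of 2]
        by (intro that[of 1 "4 # replicate q 2" "replicate (m k - 1 - 1 - q) 2 @ replicate (n k) 3"])
          (auto simp: word_def 2 simp del: One_nat_def)
    qed
  next
    case 3
    have s': "s \<in> seg c (w k 1 + w k 2) (w k 1 + w k 2 + w k 3)" using s unfolding piece_def 3 by (simp only: vals)
    define v where "v = s - (w k 1 + w k 2)"
    have v: "v \<in> seg c 0 (w k 3)" using s' unfolding v_def by (cases c) auto
    define z where "z = a + b + e + d"
    \<comment> \<open>Visits tile piece 3 with period \<open>z\<close>, in the order of the words 1,
      2, 4, 3. Word 3 makes one visit fewer, so the last period lacks its \<open>d\<close>.\<close>
    have w3: "w k 3 = real (n k) * z - d" unfolding abde z_def by (simp only: defs; linarith)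
    have abd: "0 < a" "0 < b" "0 < d" "0 < e" "0 < z" using p unfolding abde z_def by auto
    have "v \<in> seg c 0 (real (n k) * z)" using v abd unfolding w3 by (cases c) auto
    from seg_mod[OF this _ c] abd obtain q where q: "q < n k" "v - real q * z \<in> seg c 0 z" by auto
    define v0 where "v0 = v - real q * z"
    have sv: "s = w k 1 + w k 2 + v0 + real q * z" by (simp add: v0_def v_def)
    define y where "y = w k 1 + w k 2 + real q * z"
    have "v0 \<in> seg c 0 a \<or> v0 \<in> seg c a (a + b) \<or> v0 \<in> seg c (a + b) (a + b + e) \<or> v0 \<in> seg c (a + b + e) z"
      using q(2) c abd unfolding v0_def[symmetric] by (cases c) auto
    then consider (1) "v0 \<in> seg c 0 a" | (2) "v0 \<in> seg c a (a + b)" | (4) "v0 \<in> seg c (a + b) (a + b + e)"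
      | (3) "v0 \<in> seg c (a + b + e) z" by blast
    then show ?thesis
    proof cases
      case 1
      then have *: "s \<in> seg c y (y + a)" unfolding sv y_def by (cases c) auto
      have "len k + total k (4 # replicate (m k - 1) 2 @ replicate q 3) - s \<in> piece (mirror c) (Suc k) 1"
        unfolding piece_def by (rule refl[OF *]; simp only: y_def z_def defs abde total_simps; linarith)
      then show ?thesis using replicate_split[OF q(1), of 3]
        by (intro that[of 1 "4 # replicate (m k - 1) 2 @ replicate q 3" "replicate (n k - 1 - q) 3"])
          (auto simp: word_def \<open>i = 3\<close>)
    next
      case 2
      then have *: "s \<in> seg c (y + a) (y + a + b)" unfolding sv y_def by (cases c) auto
      have "len k + total k (4 # replicate (m k) 2 @ replicate q 3) - s \<in> piece (mirror c) (Suc k) 2"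
        unfolding piece_def by (rule refl[OF *]; simp only: y_def z_def defs abde total_simps; linarith)
      then show ?thesis using replicate_split[OF q(1), of 3]
        by (intro that[of 2 "4 # replicate (m k) 2 @ replicate q 3" "replicate (n k - 1 - q) 3"])
          (auto simp: word_def \<open>i = 3\<close>)
    next
      case 4
      then have *: "s \<in> seg c (y + a + b) (y + a + b + e)" unfolding sv y_def by (cases c) auto
      have "len k + total k (4 # 1 # replicate q 3) - s \<in> piece (mirror c) (Suc k) 4"
        unfolding piece_def by (rule refl[OF *]; simp only: y_def z_def defs abde total_simps; linarith)
      then show ?thesis using replicate_split[OF q(1), of 3]
        by (intro that[of 4 "4 # 1 # replicate q 3" "replicate (n k - 1 - q) 3"])
          (auto simp: word_def \<open>i = 3\<close>)
    next
      case 3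
      have "q \<noteq> n k - 1"
      proof
        assume "q = n k - 1"
        then have "v = v0 + (real (n k) - 1) * z" by (simp only: v0_def real_pred)
        then have "v = v0 + w k 3 + d - z" unfolding w3 by (simp add: algebra_simps)
        with 3 v c show False unfolding z_def by (cases c) auto
      qed
      then have q': "q < n k - 1" using q(1) by simp
      from 3 have *: "s \<in> seg c (y + a + b + e) (y + z)" unfolding sv y_def by (cases c) auto
      have "len k + total k (4 # 1 # replicate q 3) - s \<in> piece (mirror c) (Suc k) 3"
        unfolding piece_def by (rule refl[OF *]; simp only: y_def z_def defs abde total_simps; linarith)
      then show ?thesis using replicate_split[OF q', of 3]
        by (intro that[of 3 "4 # 1 # replicate q 3" "replicate (n k - 1 - 1 - q) 3"])
          (auto simp: word_def \<open>i = 3\<close> simp del: One_nat_def)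
    qed
  qed
qed

end

section \<open>Rokhlin towers over the induced intervals\<close>

locale keane = keane_lengths +
  fixes h :: "nat \<Rightarrow> nat \<Rightarrow> nat"
  assumes h_0: "h 0 i = 1"
    and h_rec: "h (Suc k) 1 = h k 4 + (m k - 1) * h k 2 + n k * h k 3"
      "h (Suc k) 2 = h k 4 + m k * h k 2 + n k * h k 3"
      "h (Suc k) 3 = h k 4 + h k 1 + (n k - 1) * h k 3"
      "h (Suc k) 4 = h k 4 + h k 1 + n k * h k 3"
begin

definition T :: "real \<Rightarrow> real" where
  "T = iet 4 keane_perm (w 0)"

definition hs :: "nat \<Rightarrow> nat list \<Rightarrow> nat" where
  "hs k ws = sum_list (map (h k) ws)"

lemma hs_simps [simp]:
  "hs k [] = 0" "hs k (i # ws) = h k i + hs k ws" "hs k (us @ vs) = hs k us + hs k vs"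
  "hs k (replicate p i) = p * h k i"
  by (auto simp: hs_def sum_list_replicate)

lemma h_word: "i \<in> {1,2,3,4} \<Longrightarrow> h (Suc k) i = hs k (word k i)"
  by (auto simp: word_def h_rec[simplified])

lemma h_pos: "i \<in> {1,2,3,4} \<Longrightarrow> 0 < h k i"
proof (induction k arbitrary: i)
  case (Suc k)
  from Suc.IH[of 4] have "0 < hs k (word k i)" by (simp add: word_def)
  with h_word[OF Suc.prems, of k] show ?case by simp
qed (simp add: h_0)

lemma iet_eq:
  assumes k: "k \<in> {1..4}" and t: "iet_s (w 0) (k - 1) \<le> t" "t < iet_s (w 0) k"
  shows "T t = t - (\<Sum>i\<in>{1..<k}. w 0 i) + (\<Sum>i\<in>{i\<in>{1..4}. keane_perm i < keane_perm k}. w 0 i)"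
proof -
  have nn: "0 \<le> w 0 i" if "i \<in> {1..4}" for i
  proof -
    have "i \<in> {1,2,3,4}" using that by auto
    then show ?thesis using w_pos[of i 0] by simp
  qed
  have mono: "iet_s (w 0) i \<le> iet_s (w 0) j" if "i \<le> j" "j \<le> 4" for i j
    unfolding iet_s_def
    by (intro sum_mono2) (use that nn in auto)
  have "(THE i. i \<in> {1..4} \<and> iet_s (w 0) (i - 1) \<le> t \<and> t < iet_s (w 0) i) = k"
  proof (rule the_equality)
    fix i assume i: "i \<in> {1..4} \<and> iet_s (w 0) (i - 1) \<le> t \<and> t < iet_s (w 0) i"
    then have "\<not> i \<le> k - 1" "\<not> k \<le> i - 1"
      using mono[of i "k - 1"] mono[of k "i - 1"] k t by force+
    then show "i = k" using i k by auto
  qed (use assms in auto)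
  then show ?thesis unfolding T_def iet_def using assms by (auto simp: Let_def)
qed

lemma T_piece:
  assumes "i \<in> {1,2,3,4}" "t \<in> piece Left_closed 0 i"
  shows "T t = t + sh 0 i"
proof -
  have s: "iet_s (w 0) 0 = 0" "iet_s (w 0) 1 = w 0 1" "iet_s (w 0) 2 = w 0 1 + w 0 2"
    "iet_s (w 0) 3 = w 0 1 + w 0 2 + w 0 3" "iet_s (w 0) 4 = w 0 1 + w 0 2 + w 0 3 + w 0 4"
    by (simp_all add: iet_s_def numeral_eq_Suc)
  have set4: "{1..4} = {1,2,3,4::nat}" by auto
  have sets: "{i \<in> {1..4}. keane_perm i < keane_perm 1} = {2,4}" "{i \<in> {1..4}. keane_perm i < keane_perm 2} = {4}"
    "{i \<in> {1..4}. keane_perm i < keane_perm 3} = {1,2,4}" "{i \<in> {1..4}. keane_perm i < keane_perm 4} = {}"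
    unfolding set4 by (auto simp: keane_perm_def)
  have ivs: "{1..<1::nat} = {}" "{1..<2::nat} = {1}" "{1..<3::nat} = {1,2}" "{1..<4::nat} = {1,2,3}" by auto
  consider "i = 1" | "i = 2" | "i = 3" | "i = 4" using assms by auto
  then show ?thesis
  proof cases
    case 1
    have "T t = t - (\<Sum>i\<in>{1..<1}. w 0 i) + (\<Sum>i\<in>{i\<in>{1..4}. keane_perm i < keane_perm 1}. w 0 i)"
      by (rule iet_eq) (use assms 1 in \<open>simp_all add: piece_def ofs_def s[simplified]\<close>)
    then show ?thesis unfolding 1 sets ivs vals by simp
  next
    case 2
    have "T t = t - (\<Sum>i\<in>{1..<2}. w 0 i) + (\<Sum>i\<in>{i\<in>{1..4}. keane_perm i < keane_perm 2}. w 0 i)"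
      by (rule iet_eq) (use assms 2 in \<open>simp_all add: piece_def ofs_def s[simplified]\<close>)
    then show ?thesis unfolding 2 sets ivs vals by simp
  next
    case 3
    have "T t = t - (\<Sum>i\<in>{1..<3}. w 0 i) + (\<Sum>i\<in>{i\<in>{1..4}. keane_perm i < keane_perm 3}. w 0 i)"
      by (rule iet_eq) (use assms 3 in \<open>simp_all add: piece_def ofs_def s[simplified]\<close>)
    then show ?thesis unfolding 3 sets ivs vals by simp
  next
    case 4
    have "T t = t - (\<Sum>i\<in>{1..<4}. w 0 i) + (\<Sum>i\<in>{i\<in>{1..4}. keane_perm i < keane_perm 4}. w 0 i)"
      by (rule iet_eq) (use assms 4 in \<open>simp_all add: piece_def ofs_def s[simplified]\<close>)
    then show ?thesis unfolding 4 sets ivs vals by simp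
  qed
qed

lemma piece_cover0:
  assumes "0 \<le> x" "x < 1"
  obtains i where "i \<in> {1,2,3,4}" "x \<in> piece Left_closed 0 i"
proof -
  have "x \<in> piece Left_closed 0 1 \<or> x \<in> piece Left_closed 0 2 \<or> x \<in> piece Left_closed 0 3 \<or> x \<in> piece Left_closed 0 4"
    using assms w_total by (auto simp: piece_def ofs_def)
  then show thesis using that by blast
qed

lemma T_bounds:
  assumes "0 \<le> x" "x < 1"
  shows "0 \<le> T x \<and> T x < 1"
proof -
  obtain i where i: "i \<in> {1,2,3,4}" "x \<in> piece Left_closed 0 i" using piece_cover0[OF assms] .
  then consider "i = 1" | "i = 2" | "i = 3" | "i = 4" by auto
  then show ?thesis using i(2) pos(1-4)[of 0] w_total
    unfolding T_piece[OF i] by cases (auto simp: piece_def vals simp del: One_nat_def)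
qed

lemma T_measurable: "T \<in> borel_measurable borel"
proof -
  have "T x = (if x \<in> piece Left_closed 0 1 then x + sh 0 1 else if x \<in> piece Left_closed 0 2 then x + sh 0 2
    else if x \<in> piece Left_closed 0 3 then x + sh 0 3 else if x \<in> piece Left_closed 0 4 then x + sh 0 4 else x)" for x
  proof (cases "0 \<le> x \<and> x < 1")
    case True
    then obtain i where "i \<in> {1,2,3,4}" "x \<in> piece Left_closed 0 i" using piece_cover0 by blast
    then show ?thesis using T_piece[of 1 x] T_piece[of 2 x] T_piece[of 3 x] T_piece[of 4 x]
      by (auto simp del: One_nat_def)
  next
    case False
    have "iet_s (w 0) (k - 1) \<ge> 0 \<and> iet_s (w 0) k \<le> 1" if "k \<in> {1..4}" for k
    proof -
      have "k \<in> {1,2,3,4}" using that by auto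
      then show ?thesis using pos(1-4)[of 0] w_total by (auto simp: iet_s_def numeral_eq_Suc)
    qed
    then have "\<not> (\<exists>k\<in>{1..4}. iet_s (w 0) (k - 1) \<le> x \<and> x < iet_s (w 0) k)"
      using False by (meson dual_order.trans less_le_trans)
    then have "T x = x" unfolding T_def iet_def by (simp only: if_False)
    moreover have "x \<notin> piece Left_closed 0 1" "x \<notin> piece Left_closed 0 2" "x \<notin> piece Left_closed 0 3"
      "x \<notin> piece Left_closed 0 4"
      using False pos(1-4)[of 0] w_total by (auto simp: piece_def vals simp del: One_nat_def)
    ultimately show ?thesis by (simp del: One_nat_def)
  qed
  then have "T = (\<lambda>x. if x \<in> piece Left_closed 0 1 then x + sh 0 1 else if x \<in> piece Left_closed 0 2 then x + sh 0 2
    else if x \<in> piece Left_closed 0 3 then x + sh 0 3 else if x \<in> piece Left_closed 0 4 then x + sh 0 4 else x)" ..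
  moreover have [measurable]: "piece Left_closed 0 i \<in> sets borel" for i by (simp add: piece_def)
  ultimately show ?thesis by simp
qed

lemma iet_data_keane: "iet_data 4 keane_perm (w 0)"
proof -
  have set4: "{1..4} = {1,2,3,4::nat}" by auto
  have "bij_betw keane_perm {1..4} {1..4}"
    unfolding set4 bij_betw_def inj_on_def by (auto simp: keane_perm_def)
  moreover have "\<forall>i\<in>{1..4}. 0 < w 0 i" unfolding set4 using w_pos by blast
  moreover have "(\<Sum>i=1..4. w 0 i) = 1" unfolding set4 using w_total by simp
  ultimately show ?thesis by (simp add: iet_data_def)
qed

primrec orient :: "nat \<Rightarrow> real" where
  "orient 0 = 1" | "orient (Suc k) = - orient k"

primrec base :: "nat \<Rightarrow> real" where
  "base 0 = 0" | "base (Suc k) = base k + orient k * len k"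

text \<open>The isometric chart of stage k into the unit interval; every stage adds one
  reflection.\<close>

definition pt :: "nat \<Rightarrow> real \<Rightarrow> real" where
  "pt k t = base k + orient k * t"

text \<open>As subsets of the unit interval all pieces are closed on the left; \<open>en k\<close>
  tells which side this is in the reflected coordinate of stage k.\<close>

primrec en :: "nat \<Rightarrow> ends" where
  "en 0 = Left_closed" | "en (Suc k) = mirror (en k)"

lemma en_not_Open: "en k \<noteq> Open"
proof -
  have "en k = Left_closed \<or> en k = Right_closed" by (induction k) auto
  then show ?thesis by auto
qed

lemma orient_cases: "orient k = 1 \<or> orient k = -1"
  by (induction k) auto

lemma pt_Suc: "pt (Suc k) t = pt k (len k - t)"
  by (simp add: pt_def algebra_simps)

lemma pt_add: "pt k (t + u) = pt k t + orient k * u"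
  by (simp add: pt_def algebra_simps)

text \<open>Below the return time all points of a piece are moved by the same amount, so one
  reference point determines it. The midpoint belongs to the piece under every convention for the
  ends.\<close>

definition \<tau> :: "nat \<Rightarrow> nat \<Rightarrow> nat \<Rightarrow> real" where
  "\<tau> k i j = (T ^^ j) (pt k (ofs k i + w k i / 2)) - pt k (ofs k i + w k i / 2)"

lemma mid_in_piece: "i \<in> {1,2,3,4} \<Longrightarrow> ofs k i + w k i / 2 \<in> piece c k i"
  using w_pos[of i k] unfolding piece_def by (cases c) auto

lemma piece_Open: "t \<in> piece Open k i \<Longrightarrow> t \<in> piece c k i"
  unfolding piece_def by (cases c) auto

definition tower_ok :: "nat \<Rightarrow> bool" where
  "tower_ok k \<longleftrightarrow> (\<forall>i\<in>{1,2,3,4}. \<forall>t\<in>piece (en k) k i. (T ^^ h k i) (pt k t) = pt k (t + sh k i) \<and>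
     (\<forall>j<h k i. (T ^^ j) (pt k t) = pt k t + \<tau> k i j))"

lemma word_orbit:
  assumes ok: "tower_ok k" and f: "follows (en k) k t ws"
  shows "(T ^^ hs k ws) (pt k t) = pt k (t + total k ws)"
  using f
proof (induction ws arbitrary: t)
  case (Cons i ws)
  then have i: "(T ^^ h k i) (pt k t) = pt k (t + sh k i)" using ok by (auto simp: tower_ok_def)
  have "(T ^^ hs k (i # ws)) (pt k t) = (T ^^ hs k ws) ((T ^^ h k i) (pt k t))"
    by (simp only: hs_simps add.commute[of "h k i"] funpow_add o_apply)
  then show ?case using Cons i by (simp add: add.assoc)
qed simp

lemma word_orbit_translation:
  assumes ok: "tower_ok k" and f: "follows (en k) k t ws" "follows (en k) k t' ws" and j: "j < hs k ws"
  shows "(T ^^ j) (pt k t) - pt k t = (T ^^ j) (pt k t') - pt k t'"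
  using f j
proof (induction ws arbitrary: t t' j)
  case (Cons i ws)
  then have i: "i \<in> {1,2,3,4}" "t \<in> piece (en k) k i" "t' \<in> piece (en k) k i" by auto
  show ?case
  proof (cases "j < h k i")
    case True
    then have "(T ^^ j) (pt k t) = pt k t + \<tau> k i j" "(T ^^ j) (pt k t') = pt k t' + \<tau> k i j"
      using ok i unfolding tower_ok_def by blast+
    then show ?thesis by simp
  next
    case False
    then obtain j' where j': "j = j' + h k i" by (metis le_add_diff_inverse2 not_less)
    have "(T ^^ h k i) (pt k t) = pt k (t + sh k i)" "(T ^^ h k i) (pt k t') = pt k (t' + sh k i)"
      using ok i unfolding tower_ok_def by blast+
    moreover have "(T ^^ j') (pt k (t + sh k i)) - pt k (t + sh k i) = (T ^^ j') (pt k (t' + sh k i)) - pt k (t' + sh k i)"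
      using Cons.prems j' by (intro Cons.IH) auto
    ultimately show ?thesis by (simp add: j' funpow_add pt_add)
  qed
qed simp

text \<open>A tower of stage k + 1 is a concatenation of towers of stage k in the order given by
  \<open>word\<close>. Points with the same word move in parallel, so translations of stage k
  compose to translations of stage k + 1.\<close>

lemma tower_ok: "tower_ok k"
proof (induction k)
  case 0
  show ?case unfolding tower_ok_def
  proof (intro ballI conjI allI impI)
    fix i t assume "i \<in> {1,2,3,4}" "t \<in> piece (en 0) 0 i"
    then show "(T ^^ h 0 i) (pt 0 t) = pt 0 (t + sh 0 i)" using T_piece by (simp add: h_0 pt_def)
  qed (simp add: h_0 \<tau>_def)
next
  case (Suc k)
  show ?case unfolding tower_ok_def
  proof (intro ballI conjI allI impI)
    fix i t assume i: "i \<in> {1,2,3,4}" and t: "t \<in> piece (en (Suc k)) (Suc k) i"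
    note f = word_follows[OF i t[unfolded en.simps]]
    show "(T ^^ h (Suc k) i) (pt (Suc k) t) = pt (Suc k) (t + sh (Suc k) i)"
      using word_orbit[OF Suc f(1)] f(2) by (simp add: h_word[OF i] pt_Suc)
    fix j assume j: "j < h (Suc k) i"
    have "ofs (Suc k) i + w (Suc k) i / 2 \<in> piece (mirror (en k)) (Suc k) i" by (rule mid_in_piece[OF i])
    note f' = word_follows(1)[OF i this]
    show "(T ^^ j) (pt (Suc k) t) = pt (Suc k) t + \<tau> (Suc k) i j"
      using word_orbit_translation[OF Suc f(1) f', of j] j unfolding \<tau>_def by (simp add: h_word[OF i] pt_Suc)
  qed
qed

lemma tower:
  assumes "i \<in> {1,2,3,4}" "t \<in> piece c k i" "c = en k \<or> c = Open"
  shows "(T ^^ h k i) (pt k t) = pt k (t + sh k i)"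
    and "j < h k i \<Longrightarrow> (T ^^ j) (pt k t) = pt k t + \<tau> k i j"
  using tower_ok[of k] assms piece_Open unfolding tower_ok_def by blast+

lemma level_nested:
  assumes i': "i' \<in> {1,2,3,4}" "word k i' = us @ i # vs"
    and t: "t \<in> piece (mirror c) (Suc k) i'" and c: "c = en k \<or> c = Open"
  shows "i \<in> {1,2,3,4}" "len k - t + total k us \<in> piece c k i"
    and "(T ^^ (r + hs k us)) (pt (Suc k) t) = (T ^^ r) (pt k (len k - t + total k us))"
    and "hs k us + h k i \<le> h (Suc k) i'"
proof -
  from word_follows(1)[OF i'(1) t] have f: "follows c k (len k - t) us"
    and p: "i \<in> {1,2,3,4}" "len k - t + total k us \<in> piece c k i" by (auto simp: i'(2))
  show "i \<in> {1,2,3,4}" "len k - t + total k us \<in> piece c k i" by fact+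
  have "mirror c = mirror (en k) \<or> mirror c = Open" using c by auto
  then have "t \<in> piece (mirror (en k)) (Suc k) i'" using t piece_Open by auto
  from word_follows(1)[OF i'(1) this] have "follows (en k) k (len k - t) us" by (simp add: i'(2))
  from word_orbit[OF tower_ok this]
  show "(T ^^ (r + hs k us)) (pt (Suc k) t) = (T ^^ r) (pt k (len k - t + total k us))"
    by (simp add: funpow_add pt_Suc)
  show "hs k us + h k i \<le> h (Suc k) i'" by (simp add: h_word[OF i'(1)] i'(2))
qed

lemma covering:
  assumes "0 \<le> x" "x < 1"
  obtains i t j where "i \<in> {1,2,3,4}" "t \<in> piece (en k) k i" "j < h k i" "x = (T ^^ j) (pt k t)"
proof -
  have "\<exists>i t j. i \<in> {1,2,3,4} \<and> t \<in> piece (en k) k i \<and> j < h k i \<and> x = (T ^^ j) (pt k t)"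
  proof (induction k)
    case 0
    obtain i where "i \<in> {1,2,3,4}" "x \<in> piece Left_closed 0 i" using piece_cover0[OF assms] .
    then show ?case by (intro exI[of _ i] exI[of _ x] exI[of _ 0]) (simp add: h_0 pt_def)
  next
    case (Suc k)
    then obtain i t j where i: "i \<in> {1,2,3,4}" "t \<in> piece (en k) k i" "j < h k i" "x = (T ^^ j) (pt k t)" by blast
    obtain i' us vs where i': "i' \<in> {1,2,3,4}" "word k i' = us @ i # vs"
      "len k + total k us - t \<in> piece (mirror (en k)) (Suc k) i'"
      using word_cover[OF en_not_Open i(1,2)] .
    note l = level_nested(3)[OF i', of j] level_nested(4)[OF i']
    show ?case
      using l i i'(1,3) by (intro exI[of _ i'] exI[of _ "len k + total k us - t"] exI[of _ "j + hs k us"]) auto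
  qed
  then show thesis using that by blast
qed

lemma pt_in_01: "i \<in> {1,2,3,4} \<Longrightarrow> t \<in> piece (en k) k i \<Longrightarrow> 0 \<le> pt k t \<and> pt k t < 1"
proof (induction k arbitrary: i t)
  case 0
  then consider "i = 1" | "i = 2" | "i = 3" | "i = 4" by auto
  then show ?case using 0(2) pos(1-4)[of 0] w_total
    by cases (auto simp: pt_def piece_def vals simp del: One_nat_def)
next
  case (Suc k)
  \<comment> \<open>Every word begins with 4, so all pieces of stage k + 1 lie in piece 4 of stage
    k.\<close>
  have "len k - t \<in> piece (en k) k 4"
    using word_follows(1)[OF Suc.prems[unfolded en.simps]] by (auto simp: word_def)
  from Suc.IH[OF _ this] show ?case by (simp add: pt_Suc)
qed

lemma orbit_in_01: "0 \<le> x \<Longrightarrow> x < 1 \<Longrightarrow> 0 \<le> (T ^^ j) x \<and> (T ^^ j) x < 1"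
  by (induction j) (use T_bounds in auto)

text \<open>The heights and the lengths are transformed by transposed matrices in opposite
  directions, so their pairing is the same at every stage.\<close>

lemma total_mass: "h k 1 * w k 1 + h k 2 * w k 2 + h k 3 * w k 3 + h k 4 * w k 4 = 1"
proof (induction k)
  case 0
  then show ?case using w_total by (simp add: h_0)
next
  case (Suc k)
  have "real (h (Suc k) 1) * w (Suc k) 1 + real (h (Suc k) 2) * w (Suc k) 2 + real (h (Suc k) 3) * w (Suc k) 3
      + real (h (Suc k) 4) * w (Suc k) 4
    = real (h k 1) * w k 1 + real (h k 2) * w k 2 + real (h k 3) * w k 3 + real (h k 4) * w k 4"
    unfolding w_rec[of k] h_rec of_nat_add of_nat_mult real_pred by algebra
  with Suc show ?case by simp
qed

lemma len_Suc: "len (Suc k) = w k 4"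
  unfolding len_def w_rec[of k] by simp

text \<open>Since \<open>2 \<le> n k\<close>, piece 3 is at least as long as piece 4, so the next
  interval takes at most half of the current one.\<close>

lemma len_le: "len k \<le> 1 / 2 ^ k"
proof (induction k)
  case 0
  then show ?case using w_total by (simp add: len_def)
next
  case (Suc k)
  have "2 * w k 4 \<le> len k"
    using pos(1-4)[of k] pos(1-4)[of "Suc k"] pos(5-10)[of "Suc k" k] w_rec[of k] unfolding len_def
    by (simp only: ring_distribs; linarith)
  then have "2 * len (Suc k) \<le> 1 / 2 ^ k" using Suc by (simp add: len_Suc)
  then show ?case by (simp add: field_simps)
qed

lemma w_le: "i \<in> {1,2,3,4} \<Longrightarrow> w k i \<le> 1 / 2 ^ k"
  using len_le[of k] pos(1-4)[of k] unfolding len_def by auto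

section \<open>Minimality\<close>

lemma seg_pieces:
  assumes "t \<in> seg c 0 (len k)" "c \<noteq> Open"
  obtains i where "i \<in> {1,2,3,4}" "t \<in> piece c k i"
proof -
  have "t \<in> piece c k 1 \<or> t \<in> piece c k 2 \<or> t \<in> piece c k 3 \<or> t \<in> piece c k 4"
    using assms pos(1-4)[of k] unfolding piece_def vals len_def by (cases c) auto
  then show thesis using that by blast
qed

lemma image_piece:
  assumes "i \<in> {1,2,3,4}" "t \<in> piece c k i" "c \<noteq> Open"
  obtains i' where "i' \<in> {1,2,3,4}" "t + sh k i \<in> piece c k i'"
proof -
  have "t + sh k i \<in> seg c 0 (len k)"
    by (rule seg_shift[OF assms(2)[unfolded piece_def]])
      (use assms(1) pos(1-4)[of k] in \<open>auto simp: vals len_def simp del: One_nat_def\<close>)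
  from seg_pieces[OF this assms(3)] that show thesis by blast
qed

lemma visit_step:
  assumes "i' \<in> {1,2,3,4}" "t \<in> piece (en (Suc k)) (Suc k) i'" "i \<in> set (word k i')"
  obtains N s where "s \<in> piece (en k) k i" "(T ^^ N) (pt (Suc k) t) = pt k s"
proof -
  obtain us vs where "word k i' = us @ i # vs" using assms(3) by (meson split_list)
  from level_nested(2)[OF assms(1) this assms(2)[unfolded en.simps]]
    level_nested(3)[OF assms(1) this assms(2)[unfolded en.simps], of 0] that show thesis by auto
qed

text \<open>A single word omits the letter 1 or the letter 2, but any composition of two consecutive
  words contains all four letters. The orbit is therefore first taken to the base of stage k +
  2.\<close>

lemma visits:
  assumes x: "0 \<le> x" "x < 1" and i: "i \<in> {1,2,3,4}"
  obtains N t where "t \<in> piece (en k) k i" "(T ^^ N) x = pt k t"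
proof -
  obtain i0 t0 j where 0: "i0 \<in> {1,2,3,4}" "t0 \<in> piece (en (Suc (Suc k))) (Suc (Suc k)) i0"
    "j < h (Suc (Suc k)) i0" "x = (T ^^ j) (pt (Suc (Suc k)) t0)"
    using covering[OF x] .
  define z where "z = t0 + sh (Suc (Suc k)) i0"
  have "(T ^^ (h (Suc (Suc k)) i0 - j)) x = pt (Suc (Suc k)) z"
    using tower(1)[OF 0(1,2)] 0(3) unfolding 0(4) z_def by (simp flip: funpow_add[unfolded comp_def, THEN fun_cong])
  then obtain N0 where N0: "(T ^^ N0) x = pt (Suc (Suc k)) z" ..
  obtain i1 where i1: "i1 \<in> {1,2,3,4}" "z \<in> piece (en (Suc (Suc k))) (Suc (Suc k)) i1"
    using image_piece[OF 0(1,2) en_not_Open] unfolding z_def .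
  obtain b where b: "b \<in> {1,2,3,4}" "b \<in> set (word (Suc k) i1)" "i \<in> set (word k b)"
  proof -
    have "0 < m k" "0 < n k" "0 < m k - 1" "0 < n k - 1" "0 < m (Suc k)" "0 < m (Suc k) - 1"
      using m2[of k] n2[of k] m2[of "Suc k"] by auto
    then have "(i \<in> {1,3,4} \<and> 4 \<in> set (word (Suc k) i1) \<and> i \<in> set (word k 4)) \<or>
      (i = 2 \<and> 1 \<in> set (word (Suc k) i1) \<and> i \<in> set (word k 1)) \<or>
      (i = 2 \<and> 2 \<in> set (word (Suc k) i1) \<and> i \<in> set (word k 2))"
      using i i1(1) by (auto simp: word_def)
    then show ?thesis using that by blast
  qed
  obtain N1 s1 where 1: "s1 \<in> piece (en (Suc k)) (Suc k) b" "(T ^^ N1) (pt (Suc (Suc k)) z) = pt (Suc k) s1"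
    using visit_step[OF i1 b(2)] .
  obtain N2 s2 where 2: "s2 \<in> piece (en k) k i" "(T ^^ N2) (pt (Suc k) s1) = pt k s2"
    using visit_step[OF b(1) 1(1) b(3)] .
  have "(T ^^ (N2 + (N1 + N0))) x = pt k s2" by (simp add: funpow_add N0 1 2)
  with 2(1) that show thesis by blast
qed

lemma minimal: "minimal_map T"
  unfolding minimal_map_def
proof (intro ballI subsetI)
  fix x y :: real assume x: "x \<in> {0..<1}" and y: "y \<in> {0..<1}"
  show "y \<in> closure (range (\<lambda>n. (T ^^ n) x))"
    unfolding closure_approachable
  proof (intro allI impI)
    fix r :: real assume "0 < r"
    then obtain k where k: "(1/2) ^ k < r" using real_arch_pow_inv[of r "1/2"] by auto
    obtain i t0 j where i: "i \<in> {1,2,3,4}" "t0 \<in> piece (en k) k i" "j < h k i" "y = (T ^^ j) (pt k t0)"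
      using covering[of y k] y by auto
    \<comment> \<open>The orbit of \<open>x\<close> reaches the piece below \<open>y\<close> and
      then climbs to the height of \<open>y\<close>; both points are lifted by the same
      translation.\<close>
    obtain N t where t: "t \<in> piece (en k) k i" "(T ^^ N) x = pt k t"
      using visits[of x i k] x i(1) by (metis atLeastLessThan_iff)
    have "(T ^^ (j + N)) x = pt k t + \<tau> k i j" using tower(2)[OF i(1) t(1) _ i(3)] t(2) by (simp add: funpow_add)
    moreover have "y = pt k t0 + \<tau> k i j" using tower(2)[OF i(1,2) _ i(3)] i(4) by simp
    ultimately have "dist ((T ^^ (j + N)) x) y = \<bar>t - t0\<bar>"
      using orient_cases[of k] by (auto simp: dist_real_def pt_def)
    also have "\<dots> \<le> w k i" using seg_le[OF t(1)[unfolded piece_def]] seg_le[OF i(2)[unfolded piece_def]] by linarith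
    also have "\<dots> \<le> 1 / 2 ^ k" by (rule w_le[OF i(1)])
    also have "\<dots> < r" using k by (simp add: power_divide)
    finally show "\<exists>z\<in>range (\<lambda>n. (T ^^ n) x). dist z y < r" by blast
  qed
qed

section \<open>Levels as open intervals\<close>

definition lo :: "nat \<Rightarrow> nat \<Rightarrow> nat \<Rightarrow> real" where
  "lo i k j = (if orient k = 1 then pt k (ofs k i) else pt k (ofs k i + w k i)) + \<tau> k i j"

lemma mem_level_iff:
  "x \<in> {lo i k j<..<lo i k j + w k i} \<longleftrightarrow> (\<exists>t\<in>piece Open k i. x = pt k t + \<tau> k i j)"
proof
  assume x: "x \<in> {lo i k j<..<lo i k j + w k i}"
  define t where "t = orient k * (x - \<tau> k i j - base k)"
  have "t \<in> piece Open k i" "x = pt k t + \<tau> k i j"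
    using x orient_cases[of k] by (auto simp: lo_def t_def piece_def pt_def)
  then show "\<exists>t\<in>piece Open k i. x = pt k t + \<tau> k i j" by blast
next
  assume "\<exists>t\<in>piece Open k i. x = pt k t + \<tau> k i j"
  then show "x \<in> {lo i k j<..<lo i k j + w k i}"
    using orient_cases[of k] by (auto simp: lo_def piece_def pt_def)
qed

lemma mem_closed_level: "t \<in> piece c k i \<Longrightarrow> pt k t + \<tau> k i j \<in> {lo i k j..lo i k j + w k i}"
  using orient_cases[of k] seg_le[of t c] unfolding lo_def piece_def pt_def by force

lemma mem_level:
  assumes "i \<in> {1,2,3,4}" "j < h k i"
  shows "x \<in> {lo i k j<..<lo i k j + w k i} \<longleftrightarrow> (\<exists>t\<in>piece Open k i. x = (T ^^ j) (pt k t))"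
  unfolding mem_level_iff using tower(2)[OF assms(1) _ _ assms(2)] by auto

text \<open>The closed levels cover the unit interval by \<open>covering\<close>, and their total
  length is 1 by \<open>total_mass\<close>, which leaves no room for an overlap.\<close>

lemma levels_disjoint:
  assumes "i \<in> {1,2,3,4}" "i' \<in> {1,2,3,4}" "j < h k i" "j' < h k i'" "(i, j) \<noteq> (i', j')"
  shows "{lo i k j<..<lo i k j + w k i} \<inter> {lo i' k j'<..<lo i' k j' + w k i'} = {}"
proof -
  define I where "I = (SIGMA i:{1,2,3,4}. {..<h k i})"
  have fin: "finite I" by (simp add: I_def)
  have "{0..<1} \<subseteq> (\<Union>(i, j)\<in>I. {lo i k j..lo i k j + w k i})"
  proof
    fix x :: real assume "x \<in> {0..<1}"
    then obtain i t j where i: "i \<in> {1,2,3,4}" "t \<in> piece (en k) k i" "j < h k i" "x = (T ^^ j) (pt k t)"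
      using covering[of x k] by auto
    have "x \<in> {lo i k j..lo i k j + w k i}"
      using mem_closed_level[OF i(2), of j] tower(2)[OF i(1,2) _ i(3)] i(4) by simp
    then show "x \<in> (\<Union>(i, j)\<in>I. {lo i k j..lo i k j + w k i})"
      using i by (intro UN_I[of "(i, j)"]) (auto simp: I_def)
  qed
  then have cov: "{0..<1} \<subseteq> (\<Union>p\<in>I. {lo (fst p) k (snd p)..lo (fst p) k (snd p) + w k (fst p)})"
    by (simp add: case_prod_beta)
  have "(\<Sum>p\<in>I. w k (fst p)) = (\<Sum>i\<in>{1,2,3,4}. \<Sum>j<h k i. w k i)"
    unfolding I_def by (subst sum.Sigma) (auto simp: case_prod_beta)
  also have "\<dots> = 1" using total_mass[of k] by simp
  finally have mass: "(\<Sum>p\<in>I. w k (fst p)) \<le> 1" by simp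
  have pos': "0 < w k (fst p)" if "p \<in> I" for p using that w_pos[of "fst p" k] by (auto simp: I_def)
  show ?thesis
    using cover_disjoint[OF fin cov pos' mass, of "(i, j)" "(i', j')"] assms by (simp add: I_def)
qed

lemma level_step:
  assumes i: "i \<in> {1,2,3,4}"
  shows "Suc j < h k i \<Longrightarrow> x \<in> {lo i k j<..<lo i k j + w k i} \<Longrightarrow> T x = x + (lo i k (Suc j) - lo i k j)"
    and "x \<in> {lo i k (h k i - 1)<..<lo i k (h k i - 1) + w k i} \<Longrightarrow>
      T x = x + (lo i k 0 - lo i k (h k i - 1)) + orient k * sh k i"
proof -
  have \<tau>: "lo i k j - lo i k j' = \<tau> k i j - \<tau> k i j'" for j j' by (simp add: lo_def)
  {
    assume j: "Suc j < h k i" and "x \<in> {lo i k j<..<lo i k j + w k i}"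
    then obtain t where t: "t \<in> piece Open k i" "x = (T ^^ j) (pt k t)" using mem_level[OF i] by auto
    have "x = pt k t + \<tau> k i j" "T x = pt k t + \<tau> k i (Suc j)"
      using tower(2)[OF i t(1), of j] tower(2)[OF i t(1), of "Suc j"] t(2) j by auto
    then show "T x = x + (lo i k (Suc j) - lo i k j)" by (simp add: \<tau>)
  }
  assume x: "x \<in> {lo i k (h k i - 1)<..<lo i k (h k i - 1) + w k i}"
  have h: "0 < h k i" by (rule h_pos[OF i])
  then obtain t where t: "t \<in> piece Open k i" "x = (T ^^ (h k i - 1)) (pt k t)" using mem_level[OF i] x by auto
  have "T x = (T ^^ Suc (h k i - 1)) (pt k t)" by (simp add: t)
  also have "\<dots> = pt k (t + sh k i)" using tower(1)[OF i t(1)] h by simp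
  finally have "T x = pt k t + orient k * sh k i" by (simp add: pt_add)
  moreover have "x = pt k t + \<tau> k i (h k i - 1)" using tower(2)[OF i t(1), of "h k i - 1"] t(2) h by simp
  moreover have "\<tau> k i 0 = 0" by (simp add: \<tau>_def)
  ultimately show "T x = x + (lo i k 0 - lo i k (h k i - 1)) + orient k * sh k i" by (simp add: \<tau>)
qed

lemma levels_subset: "i \<in> {1,2,3,4} \<Longrightarrow> (\<Union>j<h k i. {lo i k j<..<lo i k j + w k i}) \<subseteq> {0..<1}"
proof
  fix x assume i: "i \<in> {1,2,3,4}" and "x \<in> (\<Union>j<h k i. {lo i k j<..<lo i k j + w k i})"
  then obtain j t where "t \<in> piece Open k i" "x = (T ^^ j) (pt k t)" using mem_level[OF i] by auto
  then show "x \<in> {0..<1}" using orbit_in_01 pt_in_01[OF i piece_Open] by auto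
qed

lemma levels_nested:
  assumes "i' \<in> {1,2,3,4}" "word k i' = us @ i # vs" and r: "r < h k i"
  shows "{lo i' (Suc k) (r + hs k us)<..<lo i' (Suc k) (r + hs k us) + w (Suc k) i'}
    \<subseteq> {lo i k r<..<lo i k r + w k i}"
proof
  fix x assume x: "x \<in> {lo i' (Suc k) (r + hs k us)<..<lo i' (Suc k) (r + hs k us) + w (Suc k) i'}"
  have "hs k us + h k i \<le> h (Suc k) i'" by (simp add: h_word[OF assms(1)] assms(2))
  then have "r + hs k us < h (Suc k) i'" using r by simp
  then obtain t where t: "t \<in> piece Open (Suc k) i'" "x = (T ^^ (r + hs k us)) (pt (Suc k) t)"
    using x mem_level[OF assms(1)] by auto
  from level_nested(1,2)[OF assms(1,2), of t Open] level_nested(3)[OF assms(1,2), of t Open r] t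
  show "x \<in> {lo i k r<..<lo i k r + w k i}" using mem_level[OF _ r] by auto
qed

text \<open>The exceptional levels are the passage through tower 4 before the run of 2 and the
  passages through tower 3 after it.\<close>

lemma nest2:
  "(\<Union>j<h (Suc k) 2. {lo 2 (Suc k) j<..<lo 2 (Suc k) j + w (Suc k) 2}) \<subseteq>
    (\<Union>j<h k 2. {lo 2 k j<..<lo 2 k j + w k 2}) \<union>
    (\<Union>j\<in>{..<h k 4} \<union> {h k 4 + m k * h k 2..<h k 4 + m k * h k 2 + n k * h k 3}.
      {lo 2 (Suc k) j<..<lo 2 (Suc k) j + w (Suc k) 2})"
proof
  fix x assume "x \<in> (\<Union>j<h (Suc k) 2. {lo 2 (Suc k) j<..<lo 2 (Suc k) j + w (Suc k) 2})"
  then obtain j where j: "j < h (Suc k) 2" "x \<in> {lo 2 (Suc k) j<..<lo 2 (Suc k) j + w (Suc k) 2}" by auto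
  show "x \<in> (\<Union>j<h k 2. {lo 2 k j<..<lo 2 k j + w k 2}) \<union>
    (\<Union>j\<in>{..<h k 4} \<union> {h k 4 + m k * h k 2..<h k 4 + m k * h k 2 + n k * h k 3}.
      {lo 2 (Suc k) j<..<lo 2 (Suc k) j + w (Suc k) 2})"
  proof (cases "h k 4 \<le> j \<and> j < h k 4 + m k * h k 2")
    case True
    define q r where "q = (j - h k 4) div h k 2" and "r = (j - h k 4) mod h k 2"
    have h2: "0 < h k 2" by (rule h_pos) simp
    have r: "r < h k 2" using h2 by (simp add: r_def)
    have q: "q < m k" unfolding q_def using True by (intro less_mult_imp_div_less) auto
    have "j = h k 4 + (q * h k 2 + r)" using True by (simp add: q_def r_def)
    then have "j = r + hs k (4 # replicate q 2)" by simp
    moreover have "word k 2 = (4 # replicate q 2) @ 2 # (replicate (m k - 1 - q) 2 @ replicate (n k) 3)"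
      using replicate_split[OF q, of 2] by (simp add: word_def)
    ultimately have "x \<in> {lo 2 k r<..<lo 2 k r + w k 2}" using levels_nested[OF _ _ r] j(2) by blast
    then show ?thesis using r by blast
  next
    case False
    then have "j \<in> {..<h k 4} \<union> {h k 4 + m k * h k 2..<h k 4 + m k * h k 2 + n k * h k 3}"
      using j(1) h_rec(2)[of k] by auto
    then show ?thesis using j(2) by blast
  qed
qed

text \<open>In word 3 the run of 3 comes last, so the exceptional levels are exactly an initial
  block.\<close>

lemma nest3:
  "(\<Union>j<h (Suc k) 3. {lo 3 (Suc k) j<..<lo 3 (Suc k) j + w (Suc k) 3}) \<subseteq>
    (\<Union>j<h k 3. {lo 3 k j<..<lo 3 k j + w k 3}) \<union>
    (\<Union>j\<in>{..<h k 4 + h k 1}. {lo 3 (Suc k) j<..<lo 3 (Suc k) j + w (Suc k) 3})"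
proof
  fix x assume "x \<in> (\<Union>j<h (Suc k) 3. {lo 3 (Suc k) j<..<lo 3 (Suc k) j + w (Suc k) 3})"
  then obtain j where j: "j < h (Suc k) 3" "x \<in> {lo 3 (Suc k) j<..<lo 3 (Suc k) j + w (Suc k) 3}" by auto
  show "x \<in> (\<Union>j<h k 3. {lo 3 k j<..<lo 3 k j + w k 3}) \<union>
    (\<Union>j\<in>{..<h k 4 + h k 1}. {lo 3 (Suc k) j<..<lo 3 (Suc k) j + w (Suc k) 3})"
  proof (cases "h k 4 + h k 1 \<le> j")
    case True
    define q r where "q = (j - (h k 4 + h k 1)) div h k 3" and "r = (j - (h k 4 + h k 1)) mod h k 3"
    have h3: "0 < h k 3" by (rule h_pos) simp
    have r: "r < h k 3" using h3 by (simp add: r_def)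
    have q: "q < n k - 1" unfolding q_def using True j(1) h_rec(3)[of k] by (intro less_mult_imp_div_less) auto
    have "j = h k 4 + h k 1 + (q * h k 3 + r)" using True by (simp add: q_def r_def)
    then have "j = r + hs k (4 # 1 # replicate q 3)" by simp
    moreover have "word k 3 = (4 # 1 # replicate q 3) @ 3 # replicate (n k - 1 - 1 - q) 3"
      using replicate_split[OF q, of 3] by (simp add: word_def)
    ultimately have "x \<in> {lo 3 k r<..<lo 3 k r + w k 3}" using levels_nested[OF _ _ r] j(2) by blast
    then show ?thesis using r by blast
  next
    case False
    then show ?thesis using j(2) by auto
  qed
qed

end

section \<open>Consequences of rapid growth\<close>

locale keane_growth = keane +
  assumes n_big: "8 ^ (k + 1) * (h k 1 + h k 3 + h k 4) + 2 \<le> n k"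
    and m_big: "8 ^ (k + 1) * (h k 2 + h k 4 + n k * h k 3) + 2 \<le> m k"
    and mass: "1/4 \<le> h k 2 * w k 2" "1/4 \<le> h k 3 * w k 3"
begin

lemma mass_le: "i \<in> {1,2,3,4} \<Longrightarrow> real (h k i) * w k i \<le> 1"
proof -
  assume "i \<in> {1,2,3,4}"
  moreover have "0 \<le> real (h k j) * w k j" if "j \<in> {1,2,3,4}" for j using w_pos[OF that, of k] by simp
  from this[of 1] this[of 2] this[of 3] this[of 4] have
    "real (h k 1) * w k 1 \<le> 1 \<and> real (h k 2) * w k 2 \<le> 1 \<and> real (h k 3) * w k 3 \<le> 1 \<and> real (h k 4) * w k 4 \<le> 1"
    using total_mass[of k] by (simp del: One_nat_def)
  ultimately show ?thesis by auto
qed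

lemma n_ge: "8 ^ (k + 1) * (real (h k 1) + real (h k 3) + real (h k 4)) \<le> real (n k) - 1"
proof -
  have "real (8 ^ (k + 1) * (h k 1 + h k 3 + h k 4) + 2) \<le> real (n k)" using n_big[of k] of_nat_le_iff by blast
  then show ?thesis by simp
qed

lemma m_ge: "8 ^ (k + 1) * (real (h k 2) + real (h k 4) + real (n k) * real (h k 3)) \<le> real (m k) - 1"
proof -
  have "real (8 ^ (k + 1) * (h k 2 + h k 4 + n k * h k 3) + 2) \<le> real (m k)" using m_big[of k] of_nat_le_iff by blast
  then show ?thesis by simp
qed

lemma h_ge1: "i \<in> {1,2,3,4} \<Longrightarrow> 1 \<le> real (h k i)"
  using h_pos[of i k] by (metis One_nat_def Suc_leI of_nat_1 of_nat_le_iff)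

lemma h3_ge:
  assumes "i \<in> {3,4}"
  shows "8 ^ (k + 1) * (real (h k 1) + real (h k 3) + real (h k 4)) \<le> real (h (Suc k) i)"
proof -
  have "(real (n k) - 1) * 1 \<le> (real (n k) - 1) * real (h k 3)"
    using h_ge1[of 3 k] n2[of k] by (intro mult_left_mono) auto
  also have "\<dots> \<le> real (h (Suc k) i)"
  proof -
    have "real (h (Suc k) 3) = real (h k 4) + real (h k 1) + (real (n k) - 1) * real (h k 3)"
      "real (h (Suc k) 4) = real (h k 4) + real (h k 1) + (real (n k) - 1) * real (h k 3) + real (h k 3)"
      unfolding h_rec(3,4)[of k] of_nat_add of_nat_mult real_pred by algebra+
    then show ?thesis using assms by auto
  qed
  finally show ?thesis using n_ge[of k] by simp
qed

lemma h2_ge: "8 ^ (k + 1) * (real (h k 2) + real (h k 4) + real (n k) * real (h k 3)) \<le> real (h (Suc k) 2)"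
proof -
  have "real (m k) * 1 \<le> real (m k) * real (h k 2)"
    using h_ge1[of 2 k] by (intro mult_left_mono) auto
  also have "\<dots> \<le> real (h (Suc k) 2)" by (simp add: h_rec[of k])
  finally show ?thesis using m_ge[of k] by simp
qed

lemma pow8: "(1::real) \<le> 8 ^ k" "(2::real) ^ k \<le> 8 ^ k" "(8::real) ^ k \<le> 8 ^ (k + 1)"
  by (auto intro: power_mono)

lemma two_pow_le: "(2::real) ^ k \<le> 8 ^ (k + 1)"
  using pow8(2,3) by (rule order_trans)

lemma sh_pos: "i \<in> {2,3} \<Longrightarrow> 0 < sh k i"
proof -
  have "sh k 2 = w (Suc k) 1 + w (Suc k) 2" by (simp only: vals w_rec[of k]; simp)
  then show "i \<in> {2,3} \<Longrightarrow> 0 < sh k i" using pos(1-4)[of "Suc k"] pos(4)[of k] vals(7)[of k] by auto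
qed

lemma extra_le:
  assumes "i \<in> {1,2,3,4}" "8 ^ (k + 1) * r \<le> real (h (Suc k) i)"
  shows "r * w (Suc k) i \<le> 1 / 2 ^ k"
proof -
  have w: "0 < w (Suc k) i" by (rule w_pos[OF assms(1)])
  have "8 ^ (k + 1) * r * w (Suc k) i \<le> real (h (Suc k) i) * w (Suc k) i"
    using assms(2) w by (intro mult_right_mono) auto
  also have "\<dots> \<le> 1" by (rule mass_le[OF assms(1)])
  finally have "r * w (Suc k) i \<le> 1 / 8 ^ (k + 1)" by (simp add: field_simps)
  also have "\<dots> \<le> 1 / 2 ^ k" by (intro divide_left_mono two_pow_le) auto
  finally show ?thesis .
qed

text \<open>\<open>sh k 2\<close> and \<open>sh k 3\<close> are positive in the coordinate of stage
  k, so in the unit interval the drift has the sign \<open>orient k\<close>.\<close>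

lemma tower_sequence_levels:
  assumes i: "i \<in> {2,3}"
    and nest: "\<And>k. \<exists>J. finite J \<and> card J \<le> e k \<and> (\<Union>j<h (Suc k) i. {lo i (Suc k) j<..<lo i (Suc k) j + w (Suc k) i}) \<subseteq>
      (\<Union>j<h k i. {lo i k j<..<lo i k j + w k i}) \<union> (\<Union>j\<in>J. {lo i (Suc k) j<..<lo i (Suc k) j + w (Suc k) i})"
    and growth: "\<And>k. 8 ^ k * real (h k i + e k) * sh k i \<le> w k i * real (h k i)"
    and extra: "\<And>k. real (e k) * w (Suc k) i \<le> 1 / 2 ^ k"
  shows "tower_sequence T (\<lambda>k. h k i) (lo i) (\<lambda>k. w k i) (\<lambda>k. sh k i) orient e"
proof -
  have i': "i \<in> {1,2,3,4}" using i by auto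
  show ?thesis
  proof
    fix k
    show "0 < sh k i" by (rule sh_pos[OF i])
    show "orient k = 1 \<or> orient k = -1" by (rule orient_cases)
    show "(\<Union>j<h k i. {lo i k j<..<lo i k j + w k i}) \<subseteq> {0..<1}" by (rule levels_subset[OF i'])
    fix j j' assume "j < h k i" "j' < h k i" "j \<noteq> j'"
    then show "{lo i k j<..<lo i k j + w k i} \<inter> {lo i k j'<..<lo i k j' + w k i} = {}"
      using levels_disjoint[OF i' i'] by auto
  qed (use i' h_pos w_pos level_step[OF i'] nest growth extra w_le in auto)
qed

lemma towers:
  "tower_sequence T (\<lambda>k. h k 2) (lo 2) (\<lambda>k. w k 2) (\<lambda>k. sh k 2) orient (\<lambda>k. h k 4 + n k * h k 3)"
  "tower_sequence T (\<lambda>k. h k 3) (lo 3) (\<lambda>k. w k 3) (\<lambda>k. sh k 3) orient (\<lambda>k. h k 4 + h k 1)"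
proof -
  show "tower_sequence T (\<lambda>k. h k 2) (lo 2) (\<lambda>k. w k 2) (\<lambda>k. sh k 2) orient (\<lambda>k. h k 4 + n k * h k 3)"
  proof (rule tower_sequence_levels)
    fix k
    show "\<exists>J. finite J \<and> card J \<le> h k 4 + n k * h k 3 \<and>
      (\<Union>j<h (Suc k) 2. {lo 2 (Suc k) j<..<lo 2 (Suc k) j + w (Suc k) 2}) \<subseteq>
      (\<Union>j<h k 2. {lo 2 k j<..<lo 2 k j + w k 2}) \<union> (\<Union>j\<in>J. {lo 2 (Suc k) j<..<lo 2 (Suc k) j + w (Suc k) 2})"
      by (intro exI[of _ "{..<h k 4} \<union> {h k 4 + m k * h k 2..<h k 4 + m k * h k 2 + n k * h k 3}"] conjI nest2)
        (auto intro: order_trans[OF card_Un_le])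
    show "real (h k 4 + n k * h k 3) * w (Suc k) 2 \<le> 1 / 2 ^ k"
    proof (rule extra_le)
      have "8 ^ (k + 1) * real (h k 4 + n k * h k 3) \<le> 8 ^ (k + 1) * (real (h k 2) + real (h k 4) + real (n k) * real (h k 3))"
        by (intro mult_left_mono) auto
      then show "8 ^ (k + 1) * real (h k 4 + n k * h k 3) \<le> real (h (Suc k) 2)" by (rule order_trans[OF _ h2_ge])
    qed simp
    have d: "0 < sh k 2" by (rule sh_pos) simp
    \<comment> \<open>From the first to the last visit of the run in word 2, an interval of length
      \<open>w (Suc k) 2\<close> is moved \<open>m k - 1\<close> times by the drift within piece
      2.\<close>
    have "w k 2 - (real (m k) - 1) * sh k 2 = w (Suc k) 2"
      by (simp only: vals w_rec[of k] ring_distribs; simp)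
    then have "(real (m k) - 1) * sh k 2 \<le> w k 2" using pos(2)[of "Suc k"] by linarith
    have "8 ^ k * real (h k 2 + (h k 4 + n k * h k 3)) \<le> 8 ^ (k + 1) * (real (h k 2) + real (h k 4) + real (n k) * real (h k 3))"
      using pow8[of k] by (intro mult_mono) auto
    also have "\<dots> \<le> real (m k) - 1" by (rule m_ge)
    finally have "8 ^ k * real (h k 2 + (h k 4 + n k * h k 3)) * sh k 2 \<le> (real (m k) - 1) * sh k 2"
      using d by (intro mult_right_mono) auto
    also have "\<dots> \<le> w k 2" by fact
    also have "\<dots> \<le> w k 2 * real (h k 2)" using h_ge1[of 2 k] pos(2)[of k] by simp
    finally show "8 ^ k * real (h k 2 + (h k 4 + n k * h k 3)) * sh k 2 \<le> w k 2 * real (h k 2)" .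
  qed simp
  show "tower_sequence T (\<lambda>k. h k 3) (lo 3) (\<lambda>k. w k 3) (\<lambda>k. sh k 3) orient (\<lambda>k. h k 4 + h k 1)"
  proof (rule tower_sequence_levels)
    fix k
    show "\<exists>J. finite J \<and> card J \<le> h k 4 + h k 1 \<and>
      (\<Union>j<h (Suc k) 3. {lo 3 (Suc k) j<..<lo 3 (Suc k) j + w (Suc k) 3}) \<subseteq>
      (\<Union>j<h k 3. {lo 3 k j<..<lo 3 k j + w k 3}) \<union> (\<Union>j\<in>J. {lo 3 (Suc k) j<..<lo 3 (Suc k) j + w (Suc k) 3})"
      by (intro exI[of _ "{..<h k 4 + h k 1}"] conjI nest3) auto
    show "real (h k 4 + h k 1) * w (Suc k) 3 \<le> 1 / 2 ^ k"
    proof (rule extra_le)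
      have "8 ^ (k + 1) * real (h k 4 + h k 1) \<le> 8 ^ (k + 1) * (real (h k 1) + real (h k 3) + real (h k 4))"
        by (intro mult_left_mono) auto
      then show "8 ^ (k + 1) * real (h k 4 + h k 1) \<le> real (h (Suc k) 3)" by (rule order_trans[OF _ h3_ge]) simp
    qed simp
    have d: "0 < sh k 3" by (rule sh_pos) simp
    have "w k 3 - (real (n k) - 1) * sh k 3 = w (Suc k) 1 + w (Suc k) 2 + w (Suc k) 4"
      by (simp only: vals w_rec[of k] ring_distribs; simp)
    then have "(real (n k) - 1) * sh k 3 \<le> w k 3" using pos(1-4)[of "Suc k"] by linarith
    have "8 ^ k * real (h k 3 + (h k 4 + h k 1)) \<le> 8 ^ (k + 1) * (real (h k 1) + real (h k 3) + real (h k 4))"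
      using pow8[of k] by (intro mult_mono) auto
    also have "\<dots> \<le> real (n k) - 1" by (rule n_ge)
    finally have "8 ^ k * real (h k 3 + (h k 4 + h k 1)) * sh k 3 \<le> (real (n k) - 1) * sh k 3"
      using d by (intro mult_right_mono) auto
    also have "\<dots> \<le> w k 3" by fact
    also have "\<dots> \<le> w k 3 * real (h k 3)" using h_ge1[of 3 k] pos(3)[of k] by simp
    finally show "8 ^ k * real (h k 3 + (h k 4 + h k 1)) * sh k 3 \<le> w k 3 * real (h k 3)" .
  qed simp
qed

text \<open>Tower 1 is light because \<open>w k 1\<close> is made of pieces 3 and 4 of the next
  stage, whose towers are higher by at least the factor \<open>8^(k+1)\<close>. Tower 4 is light
  because its piece fits \<open>n k - 1\<close> times into piece 3.\<close>

lemma small_towers: "real (h k 1) * w k 1 + real (h k 4) * w k 4 \<le> 3 / 2 ^ k"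
proof -
  have h1: "8 ^ (k + 1) * real (h k 1) \<le> real (h (Suc k) i)" if "i \<in> {3,4}" for i
  proof -
    have "8 ^ (k + 1) * real (h k 1) \<le> 8 ^ (k + 1) * (real (h k 1) + real (h k 3) + real (h k 4))"
      by (intro mult_left_mono) auto
    then show ?thesis by (rule order_trans[OF _ h3_ge[OF that]])
  qed
  have "real (h k 1) * w k 1 = real (h k 1) * w (Suc k) 3 + real (h k 1) * w (Suc k) 4"
    by (simp only: w_rec(1)[of k] ring_distribs)
  also have "\<dots> \<le> 1 / 2 ^ k + 1 / 2 ^ k" by (intro add_mono extra_le h1) auto
  finally have 1: "real (h k 1) * w k 1 \<le> 2 / 2 ^ k" by simp
  have w4: "0 < w k 4" by (rule pos)
  have "w k 3 - (real (n k) - 1) * w k 4 = w (Suc k) 1 + w (Suc k) 2 + w (Suc k) 4"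
    by (simp only: w_rec[of k] ring_distribs; simp)
  then have w3: "(real (n k) - 1) * w k 4 \<le> w k 3" using pos(1-4)[of "Suc k"] by linarith
  have "8 ^ (k + 1) * real (h k 4) \<le> 8 ^ (k + 1) * (real (h k 1) + real (h k 3) + real (h k 4))"
    by (intro mult_left_mono) auto
  then have "8 ^ (k + 1) * real (h k 4) \<le> real (n k) - 1" by (rule order_trans[OF _ n_ge])
  then have "8 ^ (k + 1) * real (h k 4) * w k 4 \<le> (real (n k) - 1) * w k 4"
    using w4 by (intro mult_right_mono) auto
  also have "\<dots> \<le> w k 3" by (rule w3)
  also have "\<dots> \<le> 1" by (rule order_trans[OF w_le]) auto
  finally have "real (h k 4) * w k 4 \<le> 1 / 8 ^ (k + 1)" by (simp add: field_simps)
  also have "\<dots> \<le> 1 / 2 ^ k" by (intro divide_left_mono two_pow_le) auto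
  finally show ?thesis using 1 by simp
qed

lemma keane_dichotomy:
  obtains b where "1/4 \<le> b" "b \<le> 3/4"
    "AE p in lambda01 \<Otimes>\<^sub>M lambda01. phi1 T (fst p) (snd p) \<in> {0, \<infinity>}"
    "{p \<in> space (lambda01 \<Otimes>\<^sub>M lambda01). phi1 T (fst p) (snd p) = 0} \<in> sets (lambda01 \<Otimes>\<^sub>M lambda01)"
    "emeasure (lambda01 \<Otimes>\<^sub>M lambda01) {p \<in> space (lambda01 \<Otimes>\<^sub>M lambda01). phi1 T (fst p) (snd p) = 0} = ennreal b"
proof -
  interpret X: tower_sequence T "\<lambda>k. h k 2" "lo 2" "\<lambda>k. w k 2" "\<lambda>k. sh k 2" orient "\<lambda>k. h k 4 + n k * h k 3"
    "\<lambda>k j. {lo 2 k j<..<lo 2 k j + w k 2}" "\<lambda>k. \<Union>j<h k 2. {lo 2 k j<..<lo 2 k j + w k 2}"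
    by (fact towers(1)) simp_all
  interpret Y: tower_sequence T "\<lambda>k. h k 3" "lo 3" "\<lambda>k. w k 3" "\<lambda>k. sh k 3" orient "\<lambda>k. h k 4 + h k 1"
    "\<lambda>k j. {lo 3 k j<..<lo 3 k j + w k 3}" "\<lambda>k. \<Union>j<h k 3. {lo 3 k j<..<lo 3 k j + w k 3}"
    by (fact towers(2)) simp_all
  let ?X = "\<lambda>k. \<Union>j<h k 2. {lo 2 k j<..<lo 2 k j + w k 2}"
  let ?Y = "\<lambda>k. \<Union>j<h k 3. {lo 3 k j<..<lo 3 k j + w k 3}"
  have XY: "?X k \<inter> ?Y k = {}" for k
    using levels_disjoint[of 2 3 _ k] by fastforce
  have rest: "emeasure lborel ({0..<1} - (?X k \<union> ?Y k)) \<le> ennreal (3 / 2 ^ k)" for k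
  proof -
    have "emeasure lborel (?X k \<union> ?Y k) = ennreal (real (h k 2) * w k 2 + real (h k 3) * w k 3)"
      using plus_emeasure[OF _ _ XY[of k], of lborel] pos(2,3)[of k]
      unfolding X.emeasure_X Y.emeasure_X by (simp add: ennreal_plus)
    moreover have "?X k \<union> ?Y k \<subseteq> {0..<1}" using X.X_subset Y.X_subset by blast
    ultimately have "emeasure lborel ({0..<1} - (?X k \<union> ?Y k)) = ennreal 1 - ennreal (real (h k 2) * w k 2 + real (h k 3) * w k 3)"
      by (subst emeasure_Diff) (auto simp: X.X_meas Y.X_meas)
    also have "\<dots> = ennreal (1 - (real (h k 2) * w k 2 + real (h k 3) * w k 3))"
      using pos(2,3)[of k] by (intro ennreal_minus) auto
    also have "\<dots> \<le> ennreal (3 / 2 ^ k)"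
      using total_mass[of k] small_towers[of k] by (intro ennreal_leI) linarith
    finally show ?thesis .
  qed
  interpret two_towers T "\<lambda>k. h k 2" "lo 2" "\<lambda>k. w k 2" "\<lambda>k. sh k 2" orient "\<lambda>k. h k 4 + n k * h k 3"
    "\<lambda>k j. {lo 2 k j<..<lo 2 k j + w k 2}" ?X "\<lambda>k. h k 3" "lo 3" "\<lambda>k. w k 3" "\<lambda>k. sh k 3" orient "\<lambda>k. h k 4 + h k 1"
    "\<lambda>k j. {lo 3 k j<..<lo 3 k j + w k 3}" ?Y
    by unfold_locales (use XY rest in auto)
  have "ennreal (1/4) \<le> emeasure lborel (?X k)" "ennreal (1/4) \<le> emeasure lborel (?Y k)" for k
    unfolding X.emeasure_X Y.emeasure_X using mass[of k] by (auto intro!: ennreal_leI)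
  from dichotomy[OF T_measurable this] that show thesis .
qed

end

section \<open>Existence of admissible lengths\<close>

text \<open>The summand 2 leaves room for \<open>n k - 1\<close> and gives
  \<open>2 \<le> n k\<close>. With the exponent \<open>k + 1\<close> the relative loss is already
  1/8 at the first stage, small enough for the increments of \<open>bound\<close>.\<close>

definition keane_n :: "nat \<Rightarrow> (nat \<Rightarrow> nat) \<Rightarrow> nat" where
  "keane_n k H = 8 ^ (k + 1) * (H 1 + H 3 + H 4) + 2"

definition keane_m :: "nat \<Rightarrow> (nat \<Rightarrow> nat) \<Rightarrow> nat" where
  "keane_m k H = 8 ^ (k + 1) * (H 2 + H 4 + keane_n k H * H 3) + 2"

primrec keane_h :: "nat \<Rightarrow> nat \<Rightarrow> nat" where
  "keane_h 0 = (\<lambda>i. 1)"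
| "keane_h (Suc k) = (\<lambda>i.
    if i = 1 then keane_h k 4 + (keane_m k (keane_h k) - 1) * keane_h k 2 + keane_n k (keane_h k) * keane_h k 3
    else if i = 2 then keane_h k 4 + keane_m k (keane_h k) * keane_h k 2 + keane_n k (keane_h k) * keane_h k 3
    else if i = 3 then keane_h k 4 + keane_h k 1 + (keane_n k (keane_h k) - 1) * keane_h k 3
    else keane_h k 4 + keane_h k 1 + keane_n k (keane_h k) * keane_h k 3)"

definition keane_ms :: "nat \<Rightarrow> nat" where "keane_ms k = keane_m k (keane_h k)"
definition keane_ns :: "nat \<Rightarrow> nat" where "keane_ns k = keane_n k (keane_h k)"

lemma keane_h_rec:
  "keane_h (Suc k) 1 = keane_h k 4 + (keane_ms k - 1) * keane_h k 2 + keane_ns k * keane_h k 3"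
  "keane_h (Suc k) 2 = keane_h k 4 + keane_ms k * keane_h k 2 + keane_ns k * keane_h k 3"
  "keane_h (Suc k) 3 = keane_h k 4 + keane_h k 1 + (keane_ns k - 1) * keane_h k 3"
  "keane_h (Suc k) 4 = keane_h k 4 + keane_h k 1 + keane_ns k * keane_h k 3"
  by (simp_all add: keane_ms_def keane_ns_def)

lemma keane_mn_ge2: "2 \<le> keane_ms k" "2 \<le> keane_ns k"
  by (simp_all add: keane_ms_def keane_ns_def keane_m_def keane_n_def)

lemma keane_mn_pred: "real (keane_ms k - 1) = real (keane_ms k) - 1" "real (keane_ns k - 1) = real (keane_ns k) - 1"
  using keane_mn_ge2[of k] by auto

lemma keane_h_pos: "0 < keane_h k 1 \<and> 0 < keane_h k 2 \<and> 0 < keane_h k 3 \<and> 0 < keane_h k 4"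
proof (induction k)
  case (Suc k)
  then show ?case unfolding keane_h_rec by auto
qed simp

section \<open>Length vectors through all stages\<close>

type_synonym quad = "real \<times> real \<times> real \<times> real"

definition co :: "nat \<Rightarrow> quad \<Rightarrow> real" where
  "co i v = (if i = 1 then fst v else if i = 2 then fst (snd v) else if i = 3 then fst (snd (snd v))
    else snd (snd (snd v)))"

lemma co_simps [simp]: "co (Suc 0) (a, b, c, e) = a" "co 1 (a, b, c, e) = a" "co 2 (a, b, c, e) = b" "co 3 (a, b, c, e) = c" "co 4 (a, b, c, e) = e"
  by (simp_all add: co_def)

lemma co_cont [continuous_intros]: "continuous_on S f \<Longrightarrow> continuous_on S (\<lambda>x. co i (f x))"
  unfolding co_def
  by (cases "i = 1"; cases "i = 2"; cases "i = 3"; simp add: continuous_on_fst continuous_on_snd)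

text \<open>\<open>ascend k\<close> computes the lengths of stage \<open>k\<close> from those of stage \<open>k + 1\<close>, and \<open>descend k\<close> is its inverse.
  Admissibility up to stage \<open>L\<close> is a closed condition on the initial lengths that becomes stronger with \<open>L\<close>.\<close>
definition ascend :: "nat \<Rightarrow> quad \<Rightarrow> quad" where
  "ascend k v = (co 3 v + co 4 v, (real (keane_ms k) - 1) * co 1 v + real (keane_ms k) * co 2 v,
     real (keane_ns k) * (co 1 v + co 2 v + co 4 v) + (real (keane_ns k) - 1) * co 3 v, co 1 v + co 2 v + co 3 v + co 4 v)"

definition descend :: "nat \<Rightarrow> quad \<Rightarrow> quad" where
  "descend k v = (let c = real (keane_ns k) * co 4 v - co 3 v; d = co 4 v - co 1 v; a = real (keane_ms k) * d - co 2 v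
     in (a, d - a, c, co 1 v - c))"

lemma descend_ascend: "descend k (ascend k v) = v"
  by (cases v) (simp add: descend_def ascend_def Let_def algebra_simps)

lemma ascend_descend: "ascend k (descend k v) = v"
  by (cases v) (simp add: descend_def ascend_def Let_def algebra_simps)

primrec descent :: "nat \<Rightarrow> quad \<Rightarrow> quad" where
  "descent 0 v = v" | "descent (Suc k) v = descend k (descent k v)"

lemma continuous_descent: "continuous_on UNIV (descent k)"
proof (induction k)
  case (Suc k)
  have "continuous_on UNIV (\<lambda>v. descend k (descent k v))"
    unfolding descend_def Let_def by (intro continuous_intros Suc)
  then show ?case by simp
qed (simp add: continuous_on_id)

definition vol :: "nat \<Rightarrow> quad \<Rightarrow> real" where
  "vol k v = keane_h k 1 * co 1 v + keane_h k 2 * co 2 v + keane_h k 3 * co 3 v + keane_h k 4 * co 4 v"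

lemma vol_ascend: "vol k (ascend k v) = vol (Suc k) v"
  unfolding vol_def ascend_def co_simps keane_h_rec of_nat_add of_nat_mult keane_mn_pred by algebra

definition nonneg :: "quad \<Rightarrow> bool" where
  "nonneg v \<longleftrightarrow> 0 \<le> co 1 v \<and> 0 \<le> co 2 v \<and> 0 \<le> co 3 v \<and> 0 \<le> co 4 v"

text \<open>Passing from stage \<open>k + 1\<close> to stage \<open>k\<close> costs the second and third tower at most the factor \<open>1 + 1/8\<^sup>k\<^sup>+\<^sup>1\<close> of their mass;
  \<open>bound\<close> increases from \<open>1/4\<close> to \<open>1/2\<close> fast enough to absorb this.\<close>
definition bound :: "nat \<Rightarrow> real" where
  "bound k = 1/2 - 1/4 * (1/2) ^ k"

text \<open>Here \<open>A\<close> counts the levels in copies of the earlier tower, \<open>r\<close>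
  the remaining levels and \<open>x\<close> is their width. The relative loss is of order
  \<open>(1/8)^k\<close>, whereas \<open>bound\<close> gains \<open>(1/2)^k / 8\<close>.\<close>

lemma bound_step:
  fixes A r x :: real
  assumes "8 ^ (k + 1) * r \<le> A" "bound (Suc k) \<le> (A + r) * x" "0 \<le> x"
  shows "bound k \<le> A * x"
proof -
  define \<delta> :: real where "\<delta> = 1 / 8 ^ (k + 1)"
  have "r \<le> A * \<delta>" using assms(1) by (simp add: \<delta>_def field_simps)
  then have "(A + r) * x \<le> (A + A * \<delta>) * x" using assms(3) by (intro mult_right_mono) auto
  then have "bound (Suc k) \<le> A * x * (1 + \<delta>)" using assms(2) by (simp add: algebra_simps)
  moreover have "bound k * (1 + \<delta>) \<le> bound (Suc k)"
  proof -
    have "bound k * \<delta> \<le> 1/2 * \<delta>" by (intro mult_right_mono) (auto simp: bound_def \<delta>_def)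
    also have "\<dots> = 1/16 * (1/8) ^ k" by (simp add: \<delta>_def power_divide)
    also have "\<dots> \<le> 1/16 * (1/2) ^ k" by (intro mult_left_mono power_mono) auto
    also have "\<dots> \<le> 1/8 * (1/2) ^ k" by simp
    also have "\<dots> = bound (Suc k) - bound k" by (simp add: bound_def)
    finally show ?thesis by (simp add: algebra_simps)
  qed
  ultimately have "bound k * (1 + \<delta>) \<le> A * x * (1 + \<delta>)" by linarith
  moreover have "0 < 1 + \<delta>" by (simp add: \<delta>_def add_pos_pos)
  ultimately show ?thesis by simp
qed

definition admissible :: "nat \<Rightarrow> quad \<Rightarrow> bool" where
  "admissible k v \<longleftrightarrow> nonneg v \<and> vol k v = 1 \<and> bound k \<le> keane_h k 2 * co 2 v \<and> bound k \<le> keane_h k 3 * co 3 v"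

lemma admissible_ascend:
  assumes "admissible (Suc k) v"
  shows "admissible k (ascend k v)"
proof -
  have nn: "0 \<le> co 1 v" "0 \<le> co 2 v" "0 \<le> co 3 v" "0 \<le> co 4 v"
    and b: "bound (Suc k) \<le> keane_h (Suc k) 2 * co 2 v" "bound (Suc k) \<le> keane_h (Suc k) 3 * co 3 v"
    using assms by (auto simp: admissible_def nonneg_def)
  have MN: "0 \<le> real (keane_ms k) - 1" "0 \<le> real (keane_ns k) - 1" using keane_mn_ge2[of k] by auto
  have h1: "1 \<le> real (keane_h k 2)" "1 \<le> real (keane_h k 3)" using keane_h_pos[of k] by auto
  have 2: "bound k \<le> real (keane_ms k) * real (keane_h k 2) * co 2 v"
  proof (rule bound_step)
    have "8 ^ (k + 1) * (real (keane_h k 4) + real (keane_ns k) * real (keane_h k 3)) \<le> real (keane_ms k)"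
    proof -
      have "8 ^ (k + 1) * (keane_h k 4 + keane_ns k * keane_h k 3) \<le> keane_ms k"
        by (simp add: keane_ms_def keane_ns_def keane_m_def add_mult_distrib2)
      then have "real (8 ^ (k + 1) * (keane_h k 4 + keane_ns k * keane_h k 3)) \<le> real (keane_ms k)" by (rule of_nat_mono)
      then show ?thesis by simp
    qed
    also have "\<dots> \<le> real (keane_ms k) * real (keane_h k 2)" using h1 by (simp add: mult_le_cancel_left1)
    finally show "8 ^ (k + 1) * (real (keane_h k 4) + real (keane_ns k) * real (keane_h k 3)) \<le> real (keane_ms k) * real (keane_h k 2)" .
    show "bound (Suc k) \<le> (real (keane_ms k) * real (keane_h k 2) + (real (keane_h k 4) + real (keane_ns k) * real (keane_h k 3))) * co 2 v"
      using b(1) unfolding keane_h_rec by (simp add: algebra_simps)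
  qed (rule nn)
  have 3: "bound k \<le> (real (keane_ns k) - 1) * real (keane_h k 3) * co 3 v"
  proof (rule bound_step)
    have "8 ^ (k + 1) * (real (keane_h k 4) + real (keane_h k 1)) \<le> real (keane_ns k) - 1"
    proof -
      have "8 ^ (k + 1) * (keane_h k 4 + keane_h k 1) + 1 \<le> keane_ns k"
        by (simp add: keane_ns_def keane_n_def add_mult_distrib2)
      then have "real (8 ^ (k + 1) * (keane_h k 4 + keane_h k 1) + 1) \<le> real (keane_ns k)" by (rule of_nat_mono)
      then show ?thesis by simp
    qed
    also have "\<dots> \<le> (real (keane_ns k) - 1) * real (keane_h k 3)" using h1 MN by (simp add: mult_le_cancel_left1)
    finally show "8 ^ (k + 1) * (real (keane_h k 4) + real (keane_h k 1)) \<le> (real (keane_ns k) - 1) * real (keane_h k 3)" .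
    show "bound (Suc k) \<le> ((real (keane_ns k) - 1) * real (keane_h k 3) + (real (keane_h k 4) + real (keane_h k 1))) * co 3 v"
      using b(2) unfolding keane_h_rec of_nat_add of_nat_mult keane_mn_pred by (simp add: algebra_simps)
  qed (rule nn)
  have "real (keane_ms k) * co 2 v \<le> co 2 (ascend k v)" "(real (keane_ns k) - 1) * co 3 v \<le> co 3 (ascend k v)"
    using nn MN by (auto simp: ascend_def)
  then have "real (keane_h k 2) * (real (keane_ms k) * co 2 v) \<le> keane_h k 2 * co 2 (ascend k v)"
    "real (keane_h k 3) * ((real (keane_ns k) - 1) * co 3 v) \<le> keane_h k 3 * co 3 (ascend k v)"
    by (intro mult_left_mono; simp)+
  then have "bound k \<le> keane_h k 2 * co 2 (ascend k v)" "bound k \<le> keane_h k 3 * co 3 (ascend k v)"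
    using 2 3 by (simp_all add: mult_ac)
  moreover have "nonneg (ascend k v)" using nn MN by (auto simp: nonneg_def ascend_def)
  moreover have "vol k (ascend k v) = 1" using assms by (simp add: vol_ascend admissible_def)
  ultimately show ?thesis by (simp add: admissible_def)
qed

text \<open>Admissibility passes from a stage to the one before, so it suffices to give towers 2 and
  3 of stage \<open>L\<close> mass 1/2 each and to ascend; \<open>bound L\<close> is below 1/2 for
  every \<open>L\<close>.\<close>

lemma exists_admissible: "\<exists>v. \<forall>k\<le>L. admissible k (descent k v)"
proof -
  have *: "\<exists>v. descent L v = u \<and> (\<forall>k<L. descent k v = ascend k (descent (Suc k) v))" for u
  proof (induction L arbitrary: u)
    case (Suc L)
    obtain v where v: "descent L v = ascend L u" "\<forall>k<L. descent k v = ascend k (descent (Suc k) v)"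
      using Suc by blast
    then have "descent (Suc L) v = u" by (simp add: descend_ascend)
    moreover have "descent k v = ascend k (descent (Suc k) v)" if "k < Suc L" for k
      using v that by (cases "k = L") (simp_all add: ascend_descend)
    ultimately show ?case by blast
  qed simp
  define u :: quad where "u = (0, 1 / (2 * real (keane_h L 2)), 1 / (2 * real (keane_h L 3)), 0)"
  have "admissible L u"
    using keane_h_pos[of L] by (auto simp: u_def admissible_def nonneg_def vol_def bound_def)
  obtain v where v: "descent L v = u" "\<forall>k<L. descent k v = ascend k (descent (Suc k) v)" using * by blast
  have "admissible k (descent k v)" if "k \<le> L" for k
    using that
  proof (induction k rule: inc_induct)
    case base
    show ?case using v \<open>admissible L u\<close> by simp
  next
    case (step k)
    then show ?case using v(2) admissible_ascend by (metis)
  qed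
  then show ?thesis by blast
qed

text \<open>Weak inequalities survive the limit, which is why admissibility asks only for
  nonnegative lengths. The sets are bounded because all heights of stage 0 are 1, so the four
  lengths sum to 1.\<close>

lemma exists_lengths:
  obtains v where "\<And>k. admissible k (descent k v)"
proof -
  define F where "F L = {v. \<forall>k\<le>L. admissible k (descent k v)}" for L
  have "(\<Inter>L. F L) \<noteq> {}"
  proof (rule compact_nest)
    fix L
    have cl: "closed {v. admissible k (descent k v)}" for k
      unfolding admissible_def nonneg_def vol_def
      by (intro closed_Collect_conj closed_Collect_le closed_Collect_eq continuous_intros continuous_descent)
    have "F L = (\<Inter>k\<in>{..L}. {v. admissible k (descent k v)})" by (auto simp: F_def)
    then have "closed (F L)" using cl by auto
    moreover have "bounded (F L)"
    proof (rule bounded_subset)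
      show "bounded ({0..1} \<times> {0..1} \<times> {0..1} \<times> {0..1} :: quad set)"
        by (intro bounded_Times bounded_closed_interval)
      show "F L \<subseteq> {0..1} \<times> {0..1} \<times> {0..1} \<times> {0..1}"
      proof
        fix v assume "v \<in> F L"
        then have "admissible 0 v" by (force simp: F_def)
        then show "v \<in> {0..1} \<times> {0..1} \<times> {0..1} \<times> {0..1}"
          by (cases v) (auto simp: admissible_def nonneg_def vol_def simp del: One_nat_def)
      qed
    qed
    ultimately show "compact (F L)" by (simp add: compact_eq_bounded_closed)
    show "F L \<noteq> {}" using exists_admissible by (auto simp: F_def)
  qed (auto simp: F_def)
  then obtain v where "\<And>L. v \<in> F L" by blast
  then have "admissible k (descent k v)" for k by (auto simp: F_def)
  then show thesis by (rule that)
qed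

theorem theorem4p4:
  shows "\<exists>prm l b. iet_data 4 prm l \<and> minimal_map (iet 4 prm l) \<and> 1/4 \<le> b \<and> b \<le> 3/4 \<and>
    (AE p in lambda01 \<Otimes>\<^sub>M lambda01. phi1 (iet 4 prm l) (fst p) (snd p) \<in> {0, \<infinity>}) \<and>
    {p \<in> space (lambda01 \<Otimes>\<^sub>M lambda01). phi1 (iet 4 prm l) (fst p) (snd p) = 0} \<in> sets (lambda01 \<Otimes>\<^sub>M lambda01) \<and>
    emeasure (lambda01 \<Otimes>\<^sub>M lambda01) {p \<in> space (lambda01 \<Otimes>\<^sub>M lambda01). phi1 (iet 4 prm l) (fst p) (snd p) = 0} = ennreal b"
proof -
  obtain v where v: "\<And>k. admissible k (descent k v)" using exists_lengths by blast
  define w where "w k i = co i (descent k v)" for k i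
  have rec: "descent k v = ascend k (descent (Suc k) v)" for k by (simp add: ascend_descend)
  have nn: "0 \<le> w k 1" "0 \<le> w k 2" "0 \<le> w k 3" "0 \<le> w k 4" and vol: "vol k (descent k v) = 1"
    and mass: "bound k \<le> keane_h k 2 * w k 2" "bound k \<le> keane_h k 3 * w k 3" for k
    using v[of k] by (auto simp: admissible_def nonneg_def w_def)
  have b: "1/4 \<le> bound k" for k
    using power_le_one[of "1/2::real" k] by (simp add: bound_def)
  have mass: "1/4 \<le> keane_h k 2 * w k 2" "1/4 \<le> keane_h k 3 * w k 3" for k
    using mass[of k] b[of k] by linarith+
  have w_rec: "w k 1 = w (Suc k) 3 + w (Suc k) 4"
    "w k 2 = (real (keane_ms k) - 1) * w (Suc k) 1 + real (keane_ms k) * w (Suc k) 2"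
    "w k 3 = real (keane_ns k) * (w (Suc k) 1 + w (Suc k) 2 + w (Suc k) 4) + (real (keane_ns k) - 1) * w (Suc k) 3"
    "w k 4 = w (Suc k) 1 + w (Suc k) 2 + w (Suc k) 3 + w (Suc k) 4" for k
    unfolding w_def by (subst rec[of k], simp only: ascend_def co_simps)+
  \<comment> \<open>Strict positivity lost in the limit is recovered here: pieces 2 and 3 carry
    mass, and those of stage k + 1 contribute to pieces 1 and 4 of stage k.\<close>
  have "w k 2 \<noteq> 0" "w k 3 \<noteq> 0" for k using mass[of k] by auto
  then have w23: "0 < w k 2" "0 < w k 3" for k using nn[of k] by (auto simp: less_le)
  have w14: "0 < w k 1" "0 < w k 4" for k
    using w23[of "Suc k"] nn[of "Suc k"] w_rec(1,4)[of k] by linarith+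
  interpret keane_growth keane_ms keane_ns w keane_h
  proof
    show "2 \<le> keane_ms k" "2 \<le> keane_ns k" for k by (rule keane_mn_ge2)+
    show "0 < w k i" if "i \<in> {1,2,3,4}" for k i using that w23[of k] w14[of k] by auto
    show "w 0 1 + w 0 2 + w 0 3 + w 0 4 = 1" using vol[of 0] by (simp add: vol_def w_def)
    show "8 ^ (k + 1) * (keane_h k 1 + keane_h k 3 + keane_h k 4) + 2 \<le> keane_ns k" for k
      by (simp add: keane_ns_def keane_n_def)
    show "8 ^ (k + 1) * (keane_h k 2 + keane_h k 4 + keane_ns k * keane_h k 3) + 2 \<le> keane_ms k" for k
      by (simp add: keane_ms_def keane_ns_def keane_m_def)
  qed (fact w_rec keane_h_rec mass | simp)+
  obtain b where "1/4 \<le> b" "b \<le> 3/4"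
    "AE p in lambda01 \<Otimes>\<^sub>M lambda01. phi1 T (fst p) (snd p) \<in> {0, \<infinity>}"
    "{p \<in> space (lambda01 \<Otimes>\<^sub>M lambda01). phi1 T (fst p) (snd p) = 0} \<in> sets (lambda01 \<Otimes>\<^sub>M lambda01)"
    "emeasure (lambda01 \<Otimes>\<^sub>M lambda01) {p \<in> space (lambda01 \<Otimes>\<^sub>M lambda01). phi1 T (fst p) (snd p) = 0} = ennreal b"
    using keane_dichotomy .
  with iet_data_keane minimal show ?thesis unfolding T_def by blast
qed

end
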